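(* Let $D$ be a positive integer and let $G$ be a (non-random) connected graph all of whose vertex degrees are at most $D$. Suppose that the edge weights $(w_e)_{e\in E(G)}$ are i.i.d. exponential random variables with mean $1$. Let $e\in E(G)$ and $r\ge 3$ (an integer) be such that the ball $\mathbb{B}_e^r(G)$ is a tree. Then $$\varrho_r(G,e)\;\le\; 2D\,\bigl(1-(2D)^{-D}\bigr)^{r-2}.$$
   Context: A graph $G=(V(G),E(G))$ is undirected, with edges $(uv)$ being unordered pairs of distinct vertices; it may be finite or infinite. For $u,v\in V(G)$, $u\sim_G v$ means $(uv)\in E(G)$. A matching of a graph is a set of edges no two of which share a vertex. For a finite graph $H$ with edge weights $(w_e)$, the weight of a matching $M$ is $w_M=\sum_{e\in M}w_e$, and $\mathsf{M}_H$ denotes the maximum weight matching (the matching of $H$ maximizing $w_M$), which is almost surely unique for i.i.d. weights from a continuous distribution. Subgraphs of $G$ inherit the edge weights of $G$. For an edge $e=(uv)$ of $G$ and $r\ge 0$, $\mathbb{B}_e^r(G)$ is the subgraph of $G$ induced by all vertices whose graph distance (in $G$) from $u$ or from $v$ is at most $r$. For a subgraph $H$ of $G$, its boundary is $\partial H=\{v\in V(H): v\sim_G u \text{ for some } u\in V(G)\setminus V(H)\}$. For $A\subseteq V(H)$, $H\setminus A$ is the induced subgraph of $H$ on $V(H)\setminus A$. For a locally finite connected graph $G$, $e\in E(G)$ and $r\ge1$, define $$\varrho_r(G,e)=\mathbf{E}\sup_{A\subseteq \partial \mathbb{B}_e^r(G)}\bigl|\mathbf{1}_{\{e\in \mathsf{M}_{\mathbb{B}_e^r(G)}\}}-\mathbf{1}_{\{e\in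 \mathsf{M}_{\mathbb{B}_e^r(G)\setminus A}\}}\bigr|,$$ where the expectation is over the edge weights. *)

theory Defs
  imports "HOL-Probability.Probability"
begin

record 'a ugraph =
  verts :: "'a set"
  edges :: "'a set set"

definition simple_graph :: "'a ugraph \<Rightarrow> bool" where
  "simple_graph G \<longleftrightarrow>
     (\<forall>e\<in>edges G. \<exists>u v. u \<in> verts G \<and> v \<in> verts G \<and> u \<noteq> v \<and> e = {u, v})"

definition adj :: "'a ugraph \<Rightarrow> 'a \<Rightarrow> 'a \<Rightarrow> bool" where
  "adj G u v \<longleftrightarrow> {u, v} \<in> edges G"

definition neighbours :: "'a ugraph \<Rightarrow> 'a \<Rightarrow> 'a set" where
  "neighbours G v = {u \<in> verts G. adj G v u}"

(* Finiteness is explicit because card of an infinite set is 0. *)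
definition degrees_le :: "'a ugraph \<Rightarrow> nat \<Rightarrow> bool" where
  "degrees_le G D \<longleftrightarrow>
     (\<forall>v\<in>verts G. finite (neighbours G v) \<and> card (neighbours G v) \<le> D)"

definition walk :: "'a ugraph \<Rightarrow> 'a list \<Rightarrow> bool" where
  "walk G p \<longleftrightarrow> p \<noteq> [] \<and> set p \<subseteq> verts G \<and> successively (adj G) p"

definition walk_betw :: "'a ugraph \<Rightarrow> 'a \<Rightarrow> 'a list \<Rightarrow> 'a \<Rightarrow> bool" where
  "walk_betw G u p v \<longleftrightarrow> walk G p \<and> hd p = u \<and> last p = v"

definition connected_graph :: "'a ugraph \<Rightarrow> bool" where
  "connected_graph G \<longleftrightarrow>
     verts G \<noteq> {} \<and> (\<forall>u\<in>verts G. \<forall>v\<in>verts G. \<exists>p. walk_betw G u p v)"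

(* Walks are vertex lists, so the number of edges is the length minus one;
   the distance is infinite if there is no walk. *)
definition graph_dist :: "'a ugraph \<Rightarrow> 'a \<Rightarrow> 'a \<Rightarrow> enat" where
  "graph_dist G u v = (INF p\<in>{p. walk_betw G u p v}. enat (length p - 1))"

definition cycle :: "'a ugraph \<Rightarrow> 'a list \<Rightarrow> bool" where
  "cycle G p \<longleftrightarrow> walk G p \<and> distinct p \<and> length p \<ge> 3 \<and> adj G (last p) (hd p)"

definition tree :: "'a ugraph \<Rightarrow> bool" where
  "tree G \<longleftrightarrow> connected_graph G \<and> (\<nexists>p. cycle G p)"

definition induced :: "'a ugraph \<Rightarrow> 'a set \<Rightarrow> 'a ugraph" where
  "induced G S = \<lparr>verts = verts G \<inter> S, edges = {e \<in> edges G. e \<subseteq> S}\<rparr>"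

definition edge_ball :: "'a ugraph \<Rightarrow> 'a set \<Rightarrow> nat \<Rightarrow> 'a ugraph" where
  "edge_ball G e r = induced G {x \<in> verts G. \<exists>u\<in>e. graph_dist G u x \<le> enat r}"

definition boundary :: "'a ugraph \<Rightarrow> 'a ugraph \<Rightarrow> 'a set" where
  "boundary G H = {v \<in> verts H. \<exists>u \<in> verts G - verts H. adj G v u}"

definition remove_verts :: "'a ugraph \<Rightarrow> 'a set \<Rightarrow> 'a ugraph" where
  "remove_verts H A = induced H (verts H - A)"

definition is_matching :: "'a ugraph \<Rightarrow> 'a set set \<Rightarrow> bool" where
  "is_matching H M \<longleftrightarrow> M \<subseteq> edges H \<and> (\<forall>e\<in>M. \<forall>f\<in>M. e \<noteq> f \<longrightarrow> e \<inter> f = {})"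

(* For finite graphs.  Ties between maximizers, a null event for i.i.d. weights
   with a continuous distribution, are broken by the choice inside arg_max; the
   choice depends only on the set of maximizers, so it is measurable in the weights. *)
definition max_matching :: "('a set \<Rightarrow> real) \<Rightarrow> 'a ugraph \<Rightarrow> 'a set set" where
  "max_matching w H = arg_max (\<lambda>M. \<Sum>e\<in>M. w e) (is_matching H)"

(* The weight of e at the sample point x of the probability space P is w e x. *)
definition varrho ::
  "'b measure \<Rightarrow> ('a set \<Rightarrow> 'b \<Rightarrow> real) \<Rightarrow> nat \<Rightarrow> 'a ugraph \<Rightarrow> 'a set \<Rightarrow> real" where
  "varrho P w r G e =
     (\<integral>x. (SUP A\<in>Pow (boundary G (edge_ball G e r)).
            \<bar>indicat_real (max_matching (\<lambda>f. w f x) (edge_ball G e r)) e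
              - indicat_real (max_matching (\<lambda>f. w f x) (remove_verts (edge_ball G e r) A)) e\<bar>) \<partial>P)"

end

theory Submission
  imports Defs
begin

text \<open>
  Write \<open>opt\<close> for the maximum weight of a matching and let the gain of a vertex \<open>v\<close> be the decrease of
  \<open>opt\<close> when \<open>v\<close> is deleted. The gain is the maximum of 0 and of \<open>w {v, c} - gain c\<close> over the neighbours
  \<open>c\<close> of \<open>v\<close>, the gains on the right being taken in the graph without \<open>v\<close>; and \<open>e = {u, v}\<close> belongs to the
  maximum matching iff \<open>w e\<close> exceeds the sum of the gains of \<open>u\<close> and \<open>v\<close> on the two sides of \<open>e\<close>. The
  recursion is antitone, so cutting it off after \<open>r - 1\<close> steps, with extreme values at the cut, gives
  bounds \<open>L\<close> and \<open>U\<close> of the gains that hold for all \<open>A\<close> simultaneously. Hence the supremum vanishes unless \<open>w e\<close>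
  lies between the bounds, which has probability \<open>E exp (- L u) E exp (- L v) - E exp (- U u) E exp (- U v)\<close>.

  On a tree the branches at the children of \<open>v\<close> are independent, and for exponential weights the numbers
  \<open>m v = E exp (- h v)\<close>, for \<open>h\<close> either truncation, satisfy the deterministic recursion
  \<open>m v = (\<integral> s = 0..1. \<Prod>c. 1 - s * m c)\<close>. If the values of the lower and the upper truncation
  at the children differ by a factor of at most \<open>R\<close>, the substitution \<open>s \<mapsto> s / R\<close> shows that those at \<open>v\<close>
  differ by a factor of at most \<open>1 + (R - 1) * (1 - (2 D)^-D)\<close>; near the cut \<open>R \<le> D\<close>.
\<close>

section \<open>Matchings and gains\<close>

definition matchings :: "'a set set \<Rightarrow> 'a set set set" where
  "matchings E = {M. M \<subseteq> E \<and> pairwise disjnt M}"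

text \<open>A graph is represented by its edge set, so deleting the vertices in \<open>X\<close>
  means dropping every edge that meets \<open>X\<close>.\<close>

definition avoid :: "'a set set \<Rightarrow> 'a set \<Rightarrow> 'a set set" where
  "avoid E X = {f \<in> E. f \<inter> X = {}}"

definition opt :: "('a set \<Rightarrow> real) \<Rightarrow> 'a set set \<Rightarrow> real" where
  "opt w E = Max (sum w ` matchings E)"

definition gain :: "('a set \<Rightarrow> real) \<Rightarrow> 'a set set \<Rightarrow> 'a \<Rightarrow> real" where
  "gain w E v = opt w E - opt w (avoid E {v})"

definition nbrs :: "'a set set \<Rightarrow> 'a \<Rightarrow> 'a set" where
  "nbrs E v = {c. {v, c} \<in> E}"

text \<open>The right-hand side of the gain recursion with the gains of the neighbours as a
  parameter, so that exact gains, truncations and the constant 0 can all be inserted.\<close>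

definition excess :: "('a set \<Rightarrow> real) \<Rightarrow> 'a set set \<Rightarrow> 'a \<Rightarrow> ('a \<Rightarrow> real) \<Rightarrow> real" where
  "excess w E v g = Max (insert 0 ((\<lambda>c. w {v, c} - g c) ` nbrs E v))"

text \<open>
  The gain recursion truncated after \<open>k\<close> steps: an upper bound of the gain for \<open>b = True\<close> and a lower
  bound for \<open>b = False\<close>. It follows self-avoiding walks, since visited vertices are deleted.
\<close>
fun msg :: "('a set \<Rightarrow> real) \<Rightarrow> bool \<Rightarrow> nat \<Rightarrow> 'a set set \<Rightarrow> 'a \<Rightarrow> real" where
  "msg w b 0 E v = (if b then excess w E v (\<lambda>_. 0) else 0)"
| "msg w b (Suc k) E v = excess w E v (msg w (\<not> b) k (avoid E {v}))"

abbreviation two_sets :: "'a set set \<Rightarrow> bool" where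
  "two_sets E \<equiv> \<forall>f\<in>E. card f = 2"

lemma avoid_subset: "avoid E X \<subseteq> E"
  by (auto simp: avoid_def)

lemma avoid_avoid: "avoid (avoid E X) Y = avoid E (X \<union> Y)"
  by (auto simp: avoid_def)

lemma avoid_empty [simp]: "avoid E {} = E"
  by (auto simp: avoid_def)

lemma finite_avoid [simp]: "finite E \<Longrightarrow> finite (avoid E X)"
  by (auto simp: avoid_def)

lemma two_sets_avoid: "two_sets E \<Longrightarrow> two_sets (avoid E X)"
  by (auto simp: avoid_def)

lemma finite_matchings: "finite E \<Longrightarrow> finite (matchings E)"
  unfolding matchings_def by (rule finite_subset[of _ "Pow E"]) auto

lemma empty_in_matchings [simp]: "{} \<in> matchings E"
  by (simp add: matchings_def)

lemma sum_le_opt: "finite E \<Longrightarrow> M \<in> matchings E \<Longrightarrow> sum w M \<le> opt w E"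
  unfolding opt_def by (intro Max_ge) (auto simp: finite_matchings)

lemma opt_attained:
  assumes "finite E"
  obtains M where "M \<in> matchings E" "sum w M = opt w E"
proof -
  have "opt w E \<in> sum w ` matchings E"
    unfolding opt_def using assms
    by (intro Max_in) (auto simp: finite_matchings intro: empty_in_matchings)
  then show thesis using that by auto
qed

lemma opt_mono:
  assumes "finite E" "F \<subseteq> E"
  shows "opt w F \<le> opt w E"
proof -
  obtain M where "M \<in> matchings F" "sum w M = opt w F"
    using opt_attained assms finite_subset by metis
  then show ?thesis using assms sum_le_opt[of E M w] by (auto simp: matchings_def)
qed

text \<open>An optimal matching off the endpoints of \<open>f\<close> extends by \<open>f\<close>.
  For empty \<open>f\<close> nothing would be deleted, and \<open>f\<close> could be in that
  matching already.\<close>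

lemma edge_plus_opt_le:
  assumes "finite E" "f \<in> E" "f \<noteq> {}"
  shows "w f + opt w (avoid E f) \<le> opt w E"
proof -
  obtain M where M: "M \<in> matchings (avoid E f)" "sum w M = opt w (avoid E f)"
    using opt_attained[of "avoid E f"] assms by auto
  have "finite M" and "f \<notin> M"
    using M(1) assms by (auto simp: matchings_def avoid_def intro: finite_subset)
  moreover have "insert f M \<in> matchings E"
    using M(1) assms by (auto simp: matchings_def avoid_def pairwise_insert disjnt_def)
  ultimately show ?thesis using sum_le_opt[of E "insert f M" w] M(2) assms(1) by simp
qed

lemma sum_matching_le_edge_plus_opt:
  assumes "finite E" "M \<in> matchings E" "f \<in> M"
  shows "sum w M \<le> w f + opt w (avoid E f)"
proof -
  have fin: "finite M" using assms by (auto simp: matchings_def intro: finite_subset)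
  have "M - {f} \<in> matchings (avoid E f)"
    using assms unfolding matchings_def avoid_def pairwise_def disjnt_def by blast
  then have "sum w (M - {f}) \<le> opt w (avoid E f)"
    using assms by (intro sum_le_opt) auto
  then show ?thesis using sum.remove[OF fin assms(3), of w] by simp
qed

lemma two_set_other:
  assumes "card f = 2" "v \<in> f"
  obtains c where "f = {v, c}" "c \<noteq> v"
  using assms by (auto simp: card_2_iff insert_commute)

lemma finite_nbrs [simp]:
  assumes "finite E" shows "finite (nbrs E v)"
proof -
  have "(\<lambda>c. {v, c}) ` nbrs E v \<subseteq> E" by (auto simp: nbrs_def)
  moreover have "inj_on (\<lambda>c. {v, c}) (nbrs E v)"
    by (auto simp: inj_on_def doubleton_eq_iff)
  ultimately show ?thesis using assms finite_imageD finite_subset by blast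
qed

lemma nbrs_mono: "E \<subseteq> F \<Longrightarrow> nbrs E v \<subseteq> nbrs F v"
  by (auto simp: nbrs_def)

lemma excess_le_iff:
  assumes "finite E"
  shows "excess w E v g \<le> t \<longleftrightarrow> 0 \<le> t \<and> (\<forall>c\<in>nbrs E v. w {v, c} - g c \<le> t)"
  unfolding excess_def using assms by (subst Max_le_iff) auto

lemma excess_nonneg: "finite E \<Longrightarrow> 0 \<le> excess w E v g"
  unfolding excess_def by (intro Max_ge) auto

lemma excess_ge: "finite E \<Longrightarrow> c \<in> nbrs E v \<Longrightarrow> w {v, c} - g c \<le> excess w E v g"
  unfolding excess_def by (intro Max_ge) auto

lemma excess_anti_mono:
  assumes "finite E" "\<And>c. c \<in> nbrs E v \<Longrightarrow> g' c \<le> g c"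
  shows "excess w E v g \<le> excess w E v g'"
  unfolding excess_le_iff[OF assms(1)]
proof (intro conjI ballI)
  fix c assume "c \<in> nbrs E v"
  then show "w {v, c} - g c \<le> excess w E v g'"
    using assms(2)[of c] excess_ge[OF assms(1), of c v w g'] by simp
qed (simp add: excess_nonneg assms)

lemma msg_nonneg: "finite E \<Longrightarrow> 0 \<le> msg w b k E v"
  by (cases k) (auto simp: excess_nonneg)

lemma msg_mono: "finite E \<Longrightarrow> msg w False k E v \<le> msg w True k E v"
  by (induction k arbitrary: E v) (auto simp: excess_nonneg intro: excess_anti_mono)

text \<open>An optimal matching either leaves \<open>v\<close> uncovered, and then \<open>v\<close>
  has no gain, or contains some \<open>{v, c}\<close>. Since the gain of \<open>c\<close> is taken
  after deletion of \<open>v\<close>, the term for \<open>c\<close> is \<open>w {v, c}\<close> plus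
  the optimum without \<open>v\<close> and \<open>c\<close> minus the optimum without
  \<open>v\<close>.\<close>

lemma gain_eq_excess:
  assumes fin: "finite E" and two: "two_sets E"
  shows "gain w E v = excess w E v (gain w (avoid E {v}))"
proof (rule antisym)
  have eq: "avoid (avoid E {v}) {c} = avoid E {v, c}" for c
    by (simp add: avoid_avoid insert_commute)
  show "gain w E v \<le> excess w E v (gain w (avoid E {v}))"
  proof -
    obtain M where M: "M \<in> matchings E" "sum w M = opt w E" using opt_attained[OF fin] by blast
    show ?thesis
    proof (cases "\<exists>f\<in>M. v \<in> f")
      case True
      then obtain f where f: "f \<in> M" "v \<in> f" by auto
      moreover from f M two have "card f = 2" by (auto simp: matchings_def)
      ultimately obtain c where c: "f = {v, c}" using two_set_other by metis
      have "c \<in> nbrs E v" using M f c by (auto simp: nbrs_def matchings_def)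
      from excess_ge[OF fin this, of w "gain w (avoid E {v})"]
      show ?thesis
        using sum_matching_le_edge_plus_opt[OF fin M(1) f(1), of w] M(2)
        by (simp add: gain_def eq c)
    next
      case False
      then have "M \<in> matchings (avoid E {v})" using M by (auto simp: matchings_def avoid_def)
      then have "opt w E \<le> opt w (avoid E {v})"
        using sum_le_opt[of "avoid E {v}" M w] M fin by simp
      then have "gain w E v \<le> 0" by (simp add: gain_def)
      then show ?thesis using excess_nonneg[OF fin] order_trans by blast
    qed
  qed
  show "excess w E v (gain w (avoid E {v})) \<le> gain w E v"
    unfolding excess_le_iff[OF fin]
  proof (intro conjI ballI)
    show "0 \<le> gain w E v" using opt_mono[OF fin avoid_subset] by (simp add: gain_def)
    fix c assume "c \<in> nbrs E v"
    then show "w {v, c} - gain w (avoid E {v}) c \<le> gain w E v"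
      using edge_plus_opt_le[OF fin, of "{v, c}" w] by (simp add: gain_def eq nbrs_def)
  qed
qed

lemma gain_nonneg: "finite E \<Longrightarrow> 0 \<le> gain w E v"
  using opt_mono[OF _ avoid_subset] by (simp add: gain_def)

section \<open>Walks as powers of the arc relation, and two-sided bounds of the gains\<close>

definition arcs :: "'a set set \<Rightarrow> ('a \<times> 'a) set" where
  "arcs E = {(a, b). {a, b} \<in> E}"

lemma arcs_mono: "E \<subseteq> F \<Longrightarrow> arcs E \<subseteq> arcs F"
  by (auto simp: arcs_def)

lemma relpow_mono_set: "R \<subseteq> S \<Longrightarrow> (R :: ('a \<times> 'a) set) ^^ j \<subseteq> S ^^ j"
  by (induction j) (auto simp: relcomp.simps)

text \<open>Vertices of \<open>A\<close> are at least \<open>k + 1\<close> steps away from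
  \<open>v\<close>, so their deletion is not felt in the first \<open>k\<close> levels. At level 0
  neighbours may be missing and the remaining gains are only known to be nonnegative, which the two
  extreme values cover. Each further level exchanges the two bounds because \<open>excess\<close> is
  antitone in \<open>g\<close>.\<close>

lemma msg_sandwich:
  assumes "finite E" "two_sets E"
    and "\<And>j y. j \<le> k \<Longrightarrow> (v, y) \<in> arcs E ^^ j \<Longrightarrow> y \<notin> A"
  shows "msg w False k E v \<le> gain w (avoid E A) v \<and> gain w (avoid E A) v \<le> msg w True k E v"
  using assms
proof (induction k arbitrary: E v)
  case 0
  let ?g = "gain w (avoid (avoid E A) {v})"
  have "excess w (avoid E A) v ?g \<le> excess w E v (\<lambda>_. 0)"
  proof (subst excess_le_iff, goal_cases)
    case 2
    have "w {v, c} - ?g c \<le> excess w E v (\<lambda>_. 0)" if "c \<in> nbrs (avoid E A) v" for c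
    proof -
      have "c \<in> nbrs E v" using that nbrs_mono[OF avoid_subset] by fast
      moreover have "0 \<le> ?g c" using 0(1) by (intro gain_nonneg) simp
      ultimately show ?thesis using excess_ge[OF 0(1), of c v w "\<lambda>_. 0"] by simp
    qed
    then show ?case using excess_nonneg[OF 0(1)] by blast
  qed (use 0(1) in simp)
  moreover have "gain w (avoid E A) v = excess w (avoid E A) v ?g"
    by (rule gain_eq_excess[OF finite_avoid[OF 0(1)] two_sets_avoid[OF 0(2)]])
  moreover have "0 \<le> gain w (avoid E A) v"
    using 0(1) by (intro gain_nonneg) simp
  ultimately show ?case by simp
next
  case (Suc k)
  have v: "v \<notin> A" using Suc.prems(3)[of 0 v] by simp
  have c: "c \<notin> A" if "c \<in> nbrs E v" for c
    using Suc.prems(3)[of 1 c] that by (auto simp: nbrs_def arcs_def)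
  have nb: "nbrs (avoid E A) v = nbrs E v"
    using v c by (auto simp: nbrs_def avoid_def)
  have comm: "avoid (avoid E A) {v} = avoid (avoid E {v}) A"
    by (simp add: avoid_avoid)
  have g: "gain w (avoid E A) v = excess w E v (gain w (avoid (avoid E {v}) A))"
  proof -
    have "gain w (avoid E A) v = excess w (avoid E A) v (gain w (avoid (avoid E A) {v}))"
      by (rule gain_eq_excess[OF finite_avoid[OF Suc.prems(1)] two_sets_avoid[OF Suc.prems(2)]])
    then show ?thesis by (simp only: comm excess_def nb)
  qed
  have IH: "msg w False k (avoid E {v}) c \<le> gain w (avoid (avoid E {v}) A) c \<and>
      gain w (avoid (avoid E {v}) A) c \<le> msg w True k (avoid E {v}) c" if "c \<in> nbrs E v" for c
  proof (rule Suc.IH[OF finite_avoid[OF Suc.prems(1)] two_sets_avoid[OF Suc.prems(2)]])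
    fix j y assume "j \<le> k" "(c, y) \<in> arcs (avoid E {v}) ^^ j"
    then have "(c, y) \<in> arcs E ^^ j" using relpow_mono_set[OF arcs_mono[OF avoid_subset]] by blast
    moreover have "(v, c) \<in> arcs E" using that by (auto simp: nbrs_def arcs_def)
    ultimately have "(v, y) \<in> arcs E ^^ Suc j" by (blast intro: relpow_Suc_I2)
    then show "y \<notin> A" using Suc.prems(3)[of "Suc j"] \<open>j \<le> k\<close> by blast
  qed
  show ?case
    unfolding g msg.simps using IH by (intro conjI excess_anti_mono Suc.prems(1)) auto
qed

text \<open>The two gains telescope to the optimum without the edge minus the optimum without both
  endpoints, which is the price of using the edge. A strict comparison forces the same answer for
  every maximizer, so ties need no treatment here.\<close>

lemma edge_in_max_matching_iff:
  assumes fin: "finite (edges H)" and e: "{u, v} \<in> edges H"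
  defines "K \<equiv> edges H - {{u, v}}"
  shows "gain w K u + gain w (avoid K {u}) v < w {u, v} \<Longrightarrow> {u, v} \<in> max_matching w H"
    and "w {u, v} < gain w K u + gain w (avoid K {u}) v \<Longrightarrow> {u, v} \<notin> max_matching w H"
proof -
  define M where "M = max_matching w H"
  have eq: "is_matching H = (\<lambda>M. M \<in> matchings (edges H))"
    by (auto simp: fun_eq_iff is_matching_def matchings_def pairwise_def disjnt_def)
  obtain M0 where "M0 \<in> matchings (edges H)" "sum w M0 = opt w (edges H)"
    using opt_attained[OF fin] by blast
  \<comment> \<open>\<open>arg_max\<close> is a Hilbert choice, so the existence of one maximizer
    must be known before anything follows about \<open>M\<close>.\<close>
  then have "is_arg_max (sum w) (is_matching H) M0"
    using sum_le_opt[OF fin] by (auto simp: is_arg_max_def eq not_less)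
  then have "is_arg_max (sum w) (is_matching H) M"
    unfolding M_def max_matching_def arg_max_def by (rule someI)
  then have M: "M \<in> matchings (edges H)" and "sum w M0 \<le> sum w M"
    using \<open>M0 \<in> _\<close> by (auto simp: is_arg_max_def eq not_less)
  then have Mmax: "sum w M = opt w (edges H)"
    using \<open>sum w M0 = _\<close> sum_le_opt[OF fin M, of w] by simp
  have finK: "finite K" using fin by (simp add: K_def)
  have "avoid (avoid K {u}) {v} = avoid (edges H) {u, v}"
    by (auto simp: K_def avoid_def)
  then have sum_gain: "gain w K u + gain w (avoid K {u}) v = opt w K - opt w (avoid (edges H) {u, v})"
    by (simp add: gain_def)
  show "gain w K u + gain w (avoid K {u}) v < w {u, v} \<Longrightarrow> {u, v} \<in> max_matching w H"
  proof (rule ccontr)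
    assume less: "gain w K u + gain w (avoid K {u}) v < w {u, v}" and "{u, v} \<notin> max_matching w H"
    then have "M \<in> matchings K" using M by (auto simp: M_def K_def matchings_def)
    then have "opt w (edges H) \<le> opt w K" using sum_le_opt[OF finK] Mmax by metis
    then show False using less sum_gain edge_plus_opt_le[OF fin e, of w] by simp
  qed
  show "w {u, v} < gain w K u + gain w (avoid K {u}) v \<Longrightarrow> {u, v} \<notin> max_matching w H"
  proof
    assume less: "w {u, v} < gain w K u + gain w (avoid K {u}) v" and "{u, v} \<in> max_matching w H"
    then have "opt w (edges H) \<le> w {u, v} + opt w (avoid (edges H) {u, v})"
      using sum_matching_le_edge_plus_opt[OF fin M, of "{u, v}" w] Mmax by (simp add: M_def)
    moreover have "opt w K \<le> opt w (edges H)" using opt_mono[OF fin] by (auto simp: K_def)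
    ultimately show False using less sum_gain by simp
  qed
qed

section \<open>Branches of forests\<close>

text \<open>Acyclicity in the form ``every edge is a bridge''.\<close>
definition forest :: "'a set set \<Rightarrow> bool" where
  "forest E \<longleftrightarrow> (\<forall>a b. {a, b} \<in> E \<longrightarrow> (a, b) \<notin> (arcs (E - {{a, b}}))\<^sup>*)"

definition reach :: "'a set set \<Rightarrow> 'a \<Rightarrow> 'a set" where
  "reach E v = {y. (v, y) \<in> (arcs E)\<^sup>*}"

text \<open>The edges in the component of \<open>v\<close>. The recursion started at
  \<open>v\<close> reads no weight outside this set, so it serves as an index set of independent
  blocks.\<close>

definition branch :: "'a set set \<Rightarrow> 'a \<Rightarrow> 'a set set" where
  "branch E v = {f \<in> E. f \<subseteq> reach E v}"

lemma forest_subset: "forest F \<Longrightarrow> E \<subseteq> F \<Longrightarrow> forest E"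
  unfolding forest_def
proof (intro allI impI)
  fix a b assume F: "\<forall>a b. {a, b} \<in> F \<longrightarrow> (a, b) \<notin> (arcs (F - {{a, b}}))\<^sup>*" "E \<subseteq> F" "{a, b} \<in> E"
  have "(arcs (E - {{a, b}}))\<^sup>* \<subseteq> (arcs (F - {{a, b}}))\<^sup>*"
    using F(2) by (intro rtrancl_mono arcs_mono) auto
  then show "(a, b) \<notin> (arcs (E - {{a, b}}))\<^sup>*" using F by blast
qed

lemma forest_avoid: "forest E \<Longrightarrow> forest (avoid E X)"
  using forest_subset avoid_subset by blast

lemma reach_mono: "E \<subseteq> F \<Longrightarrow> reach E v \<subseteq> reach F v"
  unfolding reach_def using rtrancl_mono[OF arcs_mono] by blast

lemma reach_sym: "y \<in> reach E x \<Longrightarrow> x \<in> reach E y"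
proof -
  have "sym (arcs E)" by (auto simp: sym_def arcs_def insert_commute)
  then show "y \<in> reach E x \<Longrightarrow> x \<in> reach E y"
    using sym_rtrancl unfolding reach_def sym_def by blast
qed

lemma reach_trans: "y \<in> reach E x \<Longrightarrow> z \<in> reach E y \<Longrightarrow> z \<in> reach E x"
  unfolding reach_def by (auto intro: rtrancl_trans)

lemma branch_subset: "branch E v \<subseteq> E"
  by (auto simp: branch_def)

lemma branch_disjoint:
  assumes "two_sets E" "y \<notin> reach E x" "F \<subseteq> E"
  shows "branch E x \<inter> branch F y = {}"
proof (rule ccontr)
  assume "branch E x \<inter> branch F y \<noteq> {}"
  then obtain f where f: "f \<in> E" "f \<subseteq> reach E x" "f \<subseteq> reach F y" by (auto simp: branch_def)
  then obtain z where "z \<in> f" using assms(1) by fastforce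
  then have "z \<in> reach E x" "z \<in> reach E y" using f reach_mono[OF assms(3)] by auto
  then show False using assms(2) reach_sym reach_trans by metis
qed

lemma child_edge_in_branch:
  assumes "c \<in> nbrs E v" shows "{v, c} \<in> branch E v"
proof -
  have "(v, c) \<in> arcs E" using assms by (simp add: nbrs_def arcs_def)
  then show ?thesis using assms by (auto simp: branch_def reach_def nbrs_def)
qed

lemma child_branch_subset:
  assumes "c \<in> nbrs E v" shows "branch (avoid E {v}) c \<subseteq> branch E v"
proof -
  have "c \<in> reach E v" using assms by (auto simp: nbrs_def arcs_def reach_def)
  then have "reach (avoid E {v}) c \<subseteq> reach E v"
    using reach_mono[OF avoid_subset[of E "{v}"], of c] reach_trans[of c E v] by fast
  then show ?thesis using avoid_subset[of E "{v}"] by (auto simp: branch_def)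
qed

text \<open>A walk from \<open>c\<close> to \<open>c'\<close> that avoids \<open>v\<close> would
  join \<open>v\<close>, by way of \<open>c'\<close>, to \<open>c\<close> without the edge
  \<open>{v, c}\<close>, which is a bridge.\<close>

lemma children_separated:
  assumes "forest E" "c \<in> nbrs E v" "c' \<in> nbrs E v" "c \<noteq> c'"
  shows "c' \<notin> reach (avoid E {v}) c"
proof
  assume *: "c' \<in> reach (avoid E {v}) c"
  have sub: "avoid E {v} \<subseteq> E - {{v, c}}" by (auto simp: avoid_def)
  have "c \<in> reach (E - {{v, c}}) c'"
    using reach_sym[OF *] reach_mono[OF sub] by blast
  moreover have "(v, c') \<in> arcs (E - {{v, c}})"
    using assms by (auto simp: arcs_def nbrs_def doubleton_eq_iff)
  ultimately have "(v, c) \<in> (arcs (E - {{v, c}}))\<^sup>*"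
    unfolding reach_def by (simp add: converse_rtrancl_into_rtrancl)
  then show False using assms unfolding forest_def nbrs_def by blast
qed

text \<open>Supplies the blocks of weights behind independence, one per child. The connecting edges
  lie in no child branch, since these avoid \<open>v\<close>.\<close>

lemma child_branches_disjoint:
  assumes "two_sets E" "forest E"
  shows "disjoint_family_on (\<lambda>c. insert {v, c} (branch (avoid E {v}) c)) (nbrs E v)"
  unfolding disjoint_family_on_def
proof (intro ballI impI)
  fix c c' assume c: "c \<in> nbrs E v" "c' \<in> nbrs E v" "c \<noteq> c'"
  have "branch (avoid E {v}) c \<inter> branch (avoid E {v}) c' = {}"
    using branch_disjoint[OF two_sets_avoid[OF assms(1)] children_separated[OF assms(2) c] subset_refl] .
  moreover have "{v, d} \<notin> branch (avoid E {v}) d'" for d d'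
    by (auto simp: branch_def avoid_def)
  ultimately show "insert {v, c} (branch (avoid E {v}) c) \<inter> insert {v, c'} (branch (avoid E {v}) c') = {}"
    using c(3) by (auto simp: doubleton_eq_iff)
qed

section \<open>Locality and measurability of the truncated recursion\<close>

lemma excess_cong:
  assumes "\<And>c. c \<in> nbrs E v \<Longrightarrow> w {v, c} - g c = w' {v, c} - g' c"
  shows "excess w E v g = excess w' E v g'"
  unfolding excess_def using assms by (simp cong: image_cong_simp)

lemma msg_cong:
  assumes "\<And>f. f \<in> branch E v \<Longrightarrow> w f = w' f"
  shows "msg w b k E v = msg w' b k E v"
  using assms
proof (induction k arbitrary: b E v)
  case 0
  have "w {v, c} = w' {v, c}" if "c \<in> nbrs E v" for c
    using 0 child_edge_in_branch[OF that] by blast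
  then show ?case unfolding msg.simps by (metis excess_cong)
next
  case (Suc k)
  have "msg w (\<not> b) k (avoid E {v}) c = msg w' (\<not> b) k (avoid E {v}) c" if "c \<in> nbrs E v" for c
    using child_branch_subset[OF that] by (intro Suc.IH Suc.prems) auto
  moreover have "w {v, c} = w' {v, c}" if "c \<in> nbrs E v" for c
    using Suc.prems child_edge_in_branch[OF that] by blast
  ultimately show ?case
    unfolding msg.simps by (intro excess_cong) simp
qed

lemma excess_measurable:
  assumes "finite E"
    and "\<And>c. c \<in> nbrs E v \<Longrightarrow> (\<lambda>x. W x {v, c}) \<in> borel_measurable M"
    and "\<And>c. c \<in> nbrs E v \<Longrightarrow> (\<lambda>x. g x c) \<in> borel_measurable M"
  shows "(\<lambda>x. excess (W x) E v (g x)) \<in> borel_measurable M"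
proof (cases "nbrs E v = {}")
  case False
  have "(\<lambda>x. max 0 (Max ((\<lambda>c. W x {v, c} - g x c) ` nbrs E v))) \<in> borel_measurable M"
    by (intro borel_measurable_max borel_measurable_Max borel_measurable_diff
        borel_measurable_const finite_nbrs assms)
  then show ?thesis using False assms(1) by (simp add: excess_def)
qed (simp add: excess_def)

lemma msg_measurable:
  assumes "finite E" "\<And>f. f \<in> branch E v \<Longrightarrow> (\<lambda>x. W x f) \<in> borel_measurable M"
  shows "(\<lambda>x. msg (W x) b k E v) \<in> borel_measurable M"
  using assms
proof (induction k arbitrary: b E v)
  case 0
  have "(\<lambda>x. excess (W x) E v (\<lambda>_. 0)) \<in> borel_measurable M"
    by (intro excess_measurable 0 child_edge_in_branch borel_measurable_const)
  then show ?case by (cases b) simp_all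
next
  case (Suc k)
  have "(\<lambda>x. msg (W x) (\<not> b) k (avoid E {v}) c) \<in> borel_measurable M" if "c \<in> nbrs E v" for c
    using child_branch_subset[OF that] Suc.prems by (intro Suc.IH) auto
  then show ?case
    unfolding msg.simps by (intro excess_measurable Suc.prems child_edge_in_branch)
qed

section \<open>Contraction of the recursion\<close>

text \<open>Substituting \<open>s = R * t\<close> gives the factor \<open>R\<close>, the range
  \<open>{0..1/R}\<close> and the weight \<open>(1 - R * t) ^ l \<le> (1 - t) ^ l\<close>; as
  \<open>g\<close> is nonnegative, the range can then be enlarged to \<open>{0..1}\<close>.\<close>

lemma integral_shrink_le:
  fixes g :: "real \<Rightarrow> real"
  assumes cont: "continuous_on {0..1} g" and nonneg: "\<And>s. s \<in> {0..1} \<Longrightarrow> 0 \<le> g s" and R: "1 \<le> R"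
  shows "integral {0..1} (\<lambda>s. (1 - s) ^ l * g (s / R)) \<le> R * integral {0..1} (\<lambda>s. (1 - s) ^ l * g s)"
proof -
  have R0: "0 < R" using R by simp
  have sub: "{0..1/R} \<subseteq> {0..1}" using R by (auto simp: field_simps intro: order_trans)
  have contR: "continuous_on {0..1/R} (\<lambda>t. (1 - R * t) ^ l * g t)"
    by (intro continuous_intros continuous_on_subset[OF cont sub])
  have "((\<lambda>t. (1 - R * t) ^ l * g t) has_integral integral {0..1/R} (\<lambda>t. (1 - R * t) ^ l * g t)) (cbox 0 (1/R))"
    using integrable_continuous_real[OF contR] by (simp add: integrable_integral)
  from has_integral_affinity[OF this, of "1/R" 0]
  have "((\<lambda>s. (1 - R * (s / R)) ^ l * g (s / R)) has_integral
      R * integral {0..1/R} (\<lambda>t. (1 - R * t) ^ l * g t)) ((\<lambda>x. R * x) ` {0..1/R})"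
    using R0 by simp
  also have "(\<lambda>x. R * x) ` {0..1/R} = {0..1}"
    using R0 by (simp add: image_mult_atLeastAtMost)
  finally have "integral {0..1} (\<lambda>s. (1 - s) ^ l * g (s / R)) = R * integral {0..1/R} (\<lambda>t. (1 - R * t) ^ l * g t)"
    using R0 by (simp add: integral_unique)
  also have "integral {0..1/R} (\<lambda>t. (1 - R * t) ^ l * g t) \<le> integral {0..1/R} (\<lambda>t. (1 - t) ^ l * g t)"
  proof (intro integral_le integrable_continuous_real contR)
    show "continuous_on {0..1/R} (\<lambda>t. (1 - t) ^ l * g t)"
      by (intro continuous_intros continuous_on_subset[OF cont sub])
    fix t assume t: "t \<in> {0..1/R}"
    then have "R * t \<le> 1" "t \<le> R * t" using R R0 by (auto simp: field_simps mult_le_cancel_right1)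
    then show "(1 - R * t) ^ l * g t \<le> (1 - t) ^ l * g t"
      using t sub nonneg by (intro mult_right_mono power_mono) auto
  qed
  also have "integral {0..1/R} (\<lambda>t. (1 - t) ^ l * g t) \<le> integral {0..1} (\<lambda>t. (1 - t) ^ l * g t)"
    by (intro integral_subset_le sub integrable_continuous_real continuous_intros
        continuous_on_subset[OF cont sub] cont) (use nonneg in auto)
  finally show ?thesis using R0 by simp
qed

lemma integral_one_minus_power: "integral {0..1::real} (\<lambda>s. (1 - s) ^ l) = 1 / (real l + 1)"
proof -
  have "((\<lambda>s::real. (1 - s) ^ l) has_integral (- ((1 - 1) ^ Suc l / real (Suc l)) - - ((1 - 0) ^ Suc l / real (Suc l)))) {0..1}"
  proof (intro fundamental_theorem_of_calculus)
    fix x :: real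
    have "((\<lambda>s. - ((1 - s) ^ Suc l / real (Suc l))) has_real_derivative (1 - x) ^ l) (at x within {0..1})"
      by (auto intro!: derivative_eq_intros simp del: of_nat_Suc power_Suc)
    then show "((\<lambda>s. - ((1 - s) ^ Suc l / real (Suc l))) has_vector_derivative (1 - x) ^ l) (at x within {0..1})"
      by (simp add: has_real_derivative_iff_has_vector_derivative del: of_nat_Suc power_Suc)
  qed simp
  then show ?thesis by (simp add: integral_unique add.commute)
qed

text \<open>Subtracting the constant \<open>\<eta>\<close>, for which equality holds, reduces this to the nonnegative case.\<close>
lemma integral_shrink_gap:
  fixes h :: "real \<Rightarrow> real"
  assumes cont: "continuous_on {0..1} h" and low: "\<And>s. s \<in> {0..1} \<Longrightarrow> \<eta> \<le> h s" and R: "1 \<le> R"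
  shows "integral {0..1} (\<lambda>s. (1 - s) ^ l * h (s / R))
    \<le> R * integral {0..1} (\<lambda>s. (1 - s) ^ l * h s) - (R - 1) * \<eta> / (real l + 1)"
proof -
  let ?g = "\<lambda>s. h s - \<eta>"
  have R0: "0 < R" using R by simp
  have cR: "continuous_on {0..1} (\<lambda>s. h (s / R))"
    by (rule continuous_on_compose2[OF cont]) (use R R0 in \<open>auto intro!: continuous_intros simp: field_simps intro: order_trans\<close>)
  have split: "integral {0..1} (\<lambda>s. (1 - s) ^ l * (f s - \<eta>)) = integral {0..1} (\<lambda>s. (1 - s) ^ l * f s) - \<eta> / (real l + 1)"
    if "continuous_on {0..1} f" for f :: "real \<Rightarrow> real"
  proof -
    have "integral {0..1} (\<lambda>s. (1 - s) ^ l * f s - \<eta> * (1 - s) ^ l)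
        = integral {0..1} (\<lambda>s. (1 - s) ^ l * f s) - integral {0..1} (\<lambda>s. \<eta> * (1 - s) ^ l)"
      by (intro integral_diff integrable_continuous_real continuous_intros that)
    then show ?thesis
      by (simp add: integral_one_minus_power algebra_simps)
  qed
  have "integral {0..1} (\<lambda>s. (1 - s) ^ l * ?g (s / R)) \<le> R * integral {0..1} (\<lambda>s. (1 - s) ^ l * ?g s)"
    using low by (intro integral_shrink_le continuous_intros cont R) auto
  then show ?thesis
    unfolding split[OF cont] split[OF cR] by (simp add: algebra_simps diff_divide_distrib)
qed


text \<open>The map on means induced by one level of the recursion: the integrand is the probability
  that the maximum in \<open>excess\<close> is at most \<open>- ln s\<close>, see
  \<open>expectation_exp_neg_Max\<close>.\<close>

definition step :: "'i set \<Rightarrow> ('i \<Rightarrow> real) \<Rightarrow> real" where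
  "step N x = integral {0..1} (\<lambda>s. \<Prod>c\<in>N. 1 - s * x c)"

lemma step_mono:
  assumes "\<And>c. c \<in> N \<Longrightarrow> x c \<le> y c" "\<And>c. c \<in> N \<Longrightarrow> y c \<le> 1"
  shows "step N y \<le> step N x"
  unfolding step_def
proof (intro integral_le integrable_continuous_real continuous_intros prod_mono conjI)
  fix s :: real and c assume "s \<in> {0..1}" "c \<in> N"
  with assms[of c] mult_left_mono[of "x c" "y c" s] mult_left_mono[of "y c" 1 s]
  show "0 \<le> 1 - s * y c" "1 - s * y c \<le> 1 - s * x c" by auto
qed

lemma step_ge:
  assumes "\<And>c. c \<in> N \<Longrightarrow> x c \<le> 1"
  shows "1 / (real (card N) + 1) \<le> step N x"
  using step_mono[of N x "\<lambda>_. 1"] assms by (simp add: step_def integral_one_minus_power)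

lemma step_empty [simp]: "step {} x = 1"
  by (simp add: step_def)

lemma step_le_1:
  assumes "\<And>c. c \<in> N \<Longrightarrow> 0 \<le> x c" "\<And>c. c \<in> N \<Longrightarrow> x c \<le> 1"
  shows "step N x \<le> 1"
  using step_mono[of N "\<lambda>_. 0" x] assms by (simp add: step_def)

lemma step_le:
  assumes "finite N" "d \<in> N" "\<And>c. c \<in> N \<Longrightarrow> 0 \<le> x c" "\<And>c. c \<in> N \<Longrightarrow> x c \<le> 1" "\<alpha> \<le> x d"
  shows "step N x \<le> 1 - \<alpha> / 2"
proof -
  have "step N x \<le> integral {0..1} (\<lambda>s. 1 - \<alpha> * s)"
    unfolding step_def
  proof (intro integral_le integrable_continuous_real continuous_intros)
    fix s :: real assume s: "s \<in> {0..1}"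
    have le: "0 \<le> 1 - s * x c" "1 - s * x c \<le> 1" if "c \<in> N" for c
      using s assms(3,4)[OF that] mult_le_one[of s "x c"] by auto
    have "(\<Prod>c\<in>N. 1 - s * x c) = (1 - s * x d) * (\<Prod>c\<in>N - {d}. 1 - s * x c)"
      using assms by (intro prod.remove)
    also have "\<dots> \<le> (1 - s * x d) * 1"
      using le assms(2) by (intro mult_left_mono prod_le_1) auto
    also have "\<dots> \<le> 1 - \<alpha> * s"
      using mult_left_mono[OF assms(5), of s] s by (simp add: mult.commute)
    finally show "(\<Prod>c\<in>N. 1 - s * x c) \<le> 1 - \<alpha> * s" .
  qed
  also have "integral {0..1} (\<lambda>s::real. 1 - \<alpha> * s) = 1 - \<alpha> / 2"
  proof (rule integral_unique)
    have "((\<lambda>s::real. 1 - \<alpha> * s) has_integral ((1 - \<alpha> * 1\<^sup>2 / 2) - (0 - \<alpha> * 0\<^sup>2 / 2))) {0..1}"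
      by (rule fundamental_theorem_of_calculus)
        (auto intro!: derivative_eq_intros simp flip: has_real_derivative_iff_has_vector_derivative)
    then show "((\<lambda>s::real. 1 - \<alpha> * s) has_integral (1 - \<alpha> / 2)) {0..1}" by simp
  qed
  finally show ?thesis .
qed

text \<open>
  The children with \<open>p c = q c = 1\<close> are the leaves. Each contributes a factor \<open>1 - s\<close>, which vanishes at
  \<open>s = 1\<close>, so they are kept out of the rescaling.
\<close>
lemma step_contraction:
  assumes fin: "finite N" and card: "card N < D" and R: "1 \<le> R"
    and p: "\<And>c. c \<in> N \<Longrightarrow> 0 \<le> p c" and q: "\<And>c. c \<in> N \<Longrightarrow> q c \<le> 1"
    and pq: "\<And>c. c \<in> N \<Longrightarrow> p c \<le> R * q c"
    and alt: "\<And>c. c \<in> N \<Longrightarrow> p c = 1 \<and> q c = 1 \<or> p c \<le> 1 - 1 / (2 * real D)"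
  shows "step N q \<le> (1 + (R - 1) * (1 - 1 / (2 * real D) ^ D)) * step N p"
proof -
  define L where "L = {c \<in> N. p c = 1 \<and> q c = 1}"
  define S where "S = N - L"
  define h where "h s = (\<Prod>c\<in>S. 1 - s * p c)" for s
  define \<eta> where "\<eta> = (1 / (2 * real D)) ^ card S"
  define l where "l = card L"
  define \<epsilon> where "\<epsilon> = 1 / (2 * real D) ^ D"
  have D: "1 \<le> real D" and R0: "0 < R" using card R by auto
  have N: "N = L \<union> S" "L \<inter> S = {}" "finite L" "finite S"
    using fin by (auto simp: L_def S_def)
  have cards: "l + card S < D" using card card_Un_disjoint[of L S] N by (simp add: l_def)
  have S: "p c \<le> 1 - 1 / (2 * real D)" "p c \<le> 1" if "c \<in> S" for c
  proof -
    show *: "p c \<le> 1 - 1 / (2 * real D)" using that alt[of c] by (auto simp: S_def L_def)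
    have "0 \<le> 1 / (2 * real D)" by simp
    then show "p c \<le> 1" using * by linarith
  qed
  have prod_split: "(\<Prod>c\<in>N. f c) = (1 - s) ^ l * (\<Prod>c\<in>S. f c)"
    if "\<And>c. c \<in> L \<Longrightarrow> f c = 1 - s" for f and s :: real
    using N that by (simp add: prod.union_disjoint l_def)
  have step_p: "step N p = integral {0..1} (\<lambda>s. (1 - s) ^ l * h s)"
    unfolding step_def h_def by (intro integral_cong prod_split) (auto simp: L_def)
  \<comment> \<open>Every factor from \<open>S\<close> is at least \<open>1 / (2 * real D)\<close>
    on the unit interval; this floor is what makes the contraction strict.\<close>
  have low: "\<eta> \<le> h s" if "s \<in> {0..1}" for s
    unfolding \<eta>_def h_def prod_constant[symmetric]
  proof (intro prod_mono conjI)
    fix c assume c: "c \<in> S"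
    have "s * p c \<le> 1 * p c" using that c p by (intro mult_right_mono) (auto simp: S_def)
    then show "1 / (2 * real D) \<le> 1 - s * p c" using S[OF c] by simp
  qed simp
  have cont: "continuous_on {0..1} h" unfolding h_def by (intro continuous_intros)
  \<comment> \<open>By \<open>p c \<le> R * q c\<close>, each factor of \<open>q\<close> at
    \<open>s\<close> is at most the factor of \<open>p\<close> at \<open>s / R\<close>; the powers
    of \<open>1 - s\<close> stay unscaled.\<close>
  have "step N q \<le> integral {0..1} (\<lambda>s. (1 - s) ^ l * h (s / R))"
    unfolding step_def
  proof (intro integral_le integrable_continuous_real continuous_intros continuous_on_compose2[OF cont])
    fix s :: real assume s: "s \<in> {0..1}"
    have "(\<Prod>c\<in>N. 1 - s * q c) = (1 - s) ^ l * (\<Prod>c\<in>S. 1 - s * q c)"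
      by (rule prod_split) (auto simp: L_def)
    also have "\<dots> \<le> (1 - s) ^ l * h (s / R)"
      unfolding h_def
    proof (intro mult_left_mono prod_mono conjI)
      fix c assume c: "c \<in> S"
      then have "c \<in> N" by (auto simp: S_def)
      show "0 \<le> 1 - s * q c" using mult_left_mono[OF q[OF \<open>c \<in> N\<close>], of s] s by auto
      have "p c / R \<le> q c" using pq[OF \<open>c \<in> N\<close>] R0 by (simp add: field_simps)
      from mult_left_mono[OF this, of s] s
      show "1 - s * q c \<le> 1 - s / R * p c" by simp
    qed (use s in auto)
    finally show "(\<Prod>c\<in>N. 1 - s * q c) \<le> (1 - s) ^ l * h (s / R)" .
  qed (use R R0 in \<open>auto simp: field_simps\<close>)
  also have "\<dots> \<le> R * step N p - (R - 1) * \<eta> / (real l + 1)"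
    unfolding step_p by (rule integral_shrink_gap[OF cont low R])
  \<comment> \<open>The constant arises here: \<open>card S + 1 \<le> D\<close> and
    \<open>l + 1 \<le> 2 * D\<close> give \<open>\<epsilon> \<le> \<eta> / (l + 1)\<close>, and
    \<open>step N p \<le> 1\<close> turns the additive saving into a multiplicative one.\<close>
  also have "\<dots> \<le> R * step N p - (R - 1) * (\<epsilon> * step N p)"
  proof -
    have "\<epsilon> * step N p \<le> \<epsilon>"
    proof -
      have "p c \<le> 1" if "c \<in> N" for c
        using that S(2)[of c] by (cases "c \<in> L") (auto simp: S_def L_def)
      then have "step N p \<le> 1" using p by (intro step_le_1) auto
      then show ?thesis using mult_left_mono[of "step N p" 1 \<epsilon>] by (simp add: \<epsilon>_def)
    qed
    also have "\<epsilon> = (1 / (2 * real D)) ^ D" by (simp add: \<epsilon>_def power_one_over)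
    also have "\<dots> \<le> (1 / (2 * real D)) ^ Suc (card S)"
      using cards D by (intro power_decreasing) (auto simp: field_simps)
    also have "\<dots> = \<eta> * (1 / (2 * real D))" by (simp add: \<eta>_def)
    also have "\<dots> \<le> \<eta> * (1 / (real l + 1))"
      using cards D by (intro mult_left_mono divide_left_mono) (auto simp: \<eta>_def)
    finally have "(R - 1) * (\<epsilon> * step N p) \<le> (R - 1) * (\<eta> / (real l + 1))"
      using R by (intro mult_left_mono) auto
    then show ?thesis by simp
  qed
  also have "\<dots> = (1 + (R - 1) * (1 - \<epsilon>)) * step N p" by (simp add: algebra_simps)
  finally show ?thesis by (simp add: \<epsilon>_def)
qed

section \<open>Exponential weights\<close>

context prob_space
begin

text \<open>Fubini: condition on the value of \<open>Y\<close>. The predicate \<open>Q\<close> is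
  abstract so that strict and non-strict comparisons are treated at once.\<close>

lemma prob_exponential_compare:
  fixes X Y :: "'a \<Rightarrow> real"
  assumes indep: "indep_var borel X borel Y"
    and Y: "\<And>x. x \<in> space M \<Longrightarrow> 0 \<le> Y x"
    and Q: "Measurable.pred (borel \<Otimes>\<^sub>M borel) (\<lambda>z. Q (fst z) (snd z))"
    and tail: "\<And>y. 0 \<le> y \<Longrightarrow> prob {x \<in> space M. Q (X x) y} = exp (- y)"
  shows "prob {x \<in> space M. Q (X x) (Y x)} = expectation (\<lambda>x. exp (- Y x))"
proof -
  have X_m [measurable]: "X \<in> borel_measurable M" and Y_m [measurable]: "Y \<in> borel_measurable M"
    using indep_var_rv1[OF indep] indep_var_rv2[OF indep] by auto
  have joint: "distr M borel X \<Otimes>\<^sub>M distr M borel Y = distr M (borel \<Otimes>\<^sub>M borel) (\<lambda>x. (X x, Y x))"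
    using indep by (simp add: indep_var_distribution_eq)
  interpret X: prob_space "distr M borel X" by (rule prob_space_distr) simp
  interpret Y: prob_space "distr M borel Y" by (rule prob_space_distr) simp
  interpret XY: pair_sigma_finite "distr M borel X" "distr M borel Y" ..
  let ?A = "{z. Q (fst z) (snd z)}"
  have A: "?A \<in> sets (borel \<Otimes>\<^sub>M borel)" using Q by (simp add: pred_def space_pair_measure)
  have Q2 [measurable]: "Measurable.pred borel (\<lambda>u. Q u y)" for y
    using measurable_compose[of "\<lambda>u. (u, y)" borel "borel \<Otimes>\<^sub>M borel", OF _ Q] by simp
  have section_eq: "emeasure (distr M borel X) ((\<lambda>x. (x, y)) -` ?A) = emeasure M {x \<in> space M. Q (X x) y}" for y
    using Q2[of y] by (subst emeasure_distr)
      (auto simp: pred_def intro!: arg_cong[where f="emeasure M"])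
  have "(\<lambda>y. emeasure (distr M borel X) ((\<lambda>x. (x, y)) -` ?A)) \<in> borel_measurable (distr M borel Y)"
    using A by (intro XY.measurable_emeasure_Pair2) simp
  then have section_m: "(\<lambda>y. emeasure M {x \<in> space M. Q (X x) y}) \<in> borel_measurable (distr M borel Y)"
    unfolding section_eq .
  have "emeasure M {x \<in> space M. Q (X x) (Y x)} = emeasure (distr M (borel \<Otimes>\<^sub>M borel) (\<lambda>x. (X x, Y x))) ?A"
    using A by (subst emeasure_distr) (auto intro!: arg_cong[where f="emeasure M"])
  also have "\<dots> = (\<integral>\<^sup>+y. emeasure (distr M borel X) ((\<lambda>x. (x, y)) -` ?A) \<partial>distr M borel Y)"
    using A unfolding joint[symmetric] by (intro XY.emeasure_pair_measure_alt2) simp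
  also have "\<dots> = (\<integral>\<^sup>+y. emeasure M {x \<in> space M. Q (X x) y} \<partial>distr M borel Y)"
    unfolding section_eq ..
  also have "\<dots> = (\<integral>\<^sup>+x. emeasure M {x' \<in> space M. Q (X x') (Y x)} \<partial>M)"
    by (rule nn_integral_distr[OF Y_m section_m])
  also have "\<dots> = (\<integral>\<^sup>+x. ennreal (exp (- Y x)) \<partial>M)"
    using Y tail by (intro nn_integral_cong) (simp add: emeasure_eq_measure)
  also have "\<dots> = ennreal (expectation (\<lambda>x. exp (- Y x)))"
  proof (rule nn_integral_eq_integral)
    show "integrable M (\<lambda>x. exp (- Y x))"
      using Y by (intro integrable_const_bound[where B=1]) auto
  qed simp
  finally show ?thesis by (simp add: emeasure_eq_measure)
qed

lemma exponential_distributed_ge: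
  assumes "distributed M lborel X (exponential_density 1)" "0 \<le> a"
  shows "prob {x \<in> space M. a \<le> X x} = exp (- a)"
proof -
  have [measurable]: "X \<in> borel_measurable M"
    using distributed_measurable[OF assms(1)] by simp
  have "emeasure M (X -` {a} \<inter> space M) = (\<integral>\<^sup>+x. ennreal (exponential_density 1 x) * indicator {a} x \<partial>lborel)"
    by (rule distributed_emeasure[OF assms(1)]) simp
  also have "\<dots> = 0"
    by (subst nn_integral_0_iff_AE) (auto intro!: AE_I'[of "{a}"] simp: indicator_def)
  finally have "prob {x \<in> space M. X x = a} = 0"
    by (simp add: emeasure_eq_measure vimage_def Int_def conj_commute)
  moreover have "prob {x \<in> space M. a \<le> X x} = prob {x \<in> space M. a < X x} + prob {x \<in> space M. X x = a}"
    by (subst finite_measure_Union[symmetric]) (auto intro!: arg_cong[where f=prob])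
  ultimately show ?thesis using exponential_distributedD_gt[OF assms] by simp
qed

lemma prob_compare_exponential:
  fixes X Y :: "'a \<Rightarrow> real"
  assumes "distributed M lborel X (exponential_density 1)" "indep_var borel X borel Y"
    and "\<And>x. x \<in> space M \<Longrightarrow> 0 \<le> Y x"
  shows "prob {x \<in> space M. Y x < X x} = expectation (\<lambda>x. exp (- Y x))"
    and "prob {x \<in> space M. Y x \<le> X x} = expectation (\<lambda>x. exp (- Y x))"
    and "prob {x \<in> space M. X x \<le> Y x} = 1 - expectation (\<lambda>x. exp (- Y x))"
proof -
  have [measurable]: "X \<in> borel_measurable M" "Y \<in> borel_measurable M"
    using indep_var_rv1[OF assms(2)] indep_var_rv2[OF assms(2)] by auto
  show gt: "prob {x \<in> space M. Y x < X x} = expectation (\<lambda>x. exp (- Y x))"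
    using exponential_distributedD_gt[OF assms(1)]
    by (intro prob_exponential_compare[where Q = "\<lambda>x y. y < x"] assms) auto
  show "prob {x \<in> space M. Y x \<le> X x} = expectation (\<lambda>x. exp (- Y x))"
    using exponential_distributed_ge[OF assms(1)]
    by (intro prob_exponential_compare[where Q = "\<lambda>x y. y \<le> x"] assms) auto
  have "prob {x \<in> space M. X x \<le> Y x} = 1 - prob {x \<in> space M. Y x < X x}"
    by (subst prob_neg[symmetric]) (auto intro!: arg_cong[where f=prob] simp: not_less)
  then show "prob {x \<in> space M. X x \<le> Y x} = 1 - expectation (\<lambda>x. exp (- Y x))"
    using gt by simp
qed

text \<open>\<open>exp (- H)\<close> is the length of the set of all \<open>s\<close> with \<open>0 < s\<close> and \<open>H \<le> - ln s\<close>; then use Fubini.\<close>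
lemma expectation_exp_neg:
  assumes [measurable]: "H \<in> borel_measurable M" and H: "\<And>x. x \<in> space M \<Longrightarrow> 0 \<le> H x"
    and cdf: "\<And>s. 0 < s \<Longrightarrow> s \<le> 1 \<Longrightarrow> prob {x \<in> space M. H x \<le> - ln s} = \<phi> s"
    and cont: "continuous_on {0..1} \<phi>" and nonneg: "\<And>s. s \<in> {0..1} \<Longrightarrow> 0 \<le> \<phi> s"
  shows "expectation (\<lambda>x. exp (- H x)) = integral {0..1} \<phi>"
proof -
  interpret S: pair_sigma_finite M lborel ..
  let ?S = "{z \<in> space (M \<Otimes>\<^sub>M lborel). 0 < snd z \<and> snd z \<le> exp (- H (fst z))}"
  have "ennreal (expectation (\<lambda>x. exp (- H x))) = (\<integral>\<^sup>+x. ennreal (exp (- H x)) \<partial>M)"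
    using H by (intro nn_integral_eq_integral[symmetric] integrable_const_bound[where B=1]) auto
  also have "\<dots> = (\<integral>\<^sup>+x. emeasure lborel (Pair x -` ?S) \<partial>M)"
  proof (intro nn_integral_cong)
    fix x assume "x \<in> space M"
    then have "Pair x -` ?S = {0<..exp (- H x)}" by (auto simp: space_pair_measure)
    then show "ennreal (exp (- H x)) = emeasure lborel (Pair x -` ?S)" by simp
  qed
  also have "\<dots> = emeasure (M \<Otimes>\<^sub>M lborel) ?S"
    by (rule lborel.emeasure_pair_measure_alt[symmetric]) measurable
  also have "\<dots> = (\<integral>\<^sup>+s. emeasure M ((\<lambda>x. (x, s)) -` ?S) \<partial>lborel)"
    by (rule S.emeasure_pair_measure_alt2) measurable
  also have "\<dots> = (\<integral>\<^sup>+s. ennreal (\<phi> s) * indicator {0..1} s \<partial>lborel)"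
  \<comment> \<open>The point \<open>s = 0\<close> is excluded as a null set: the section there is
    empty, whereas \<open>\<phi> 0\<close> may be positive.\<close>
  proof (intro nn_integral_cong_AE AE_mp[OF AE_lborel_singleton[of 0] AE_I2] impI)
    fix s :: real assume s: "s \<noteq> 0"
    have eq: "(\<lambda>x. (x, s)) -` ?S = {x \<in> space M. 0 < s \<and> s \<le> exp (- H x)}"
      by (auto simp: space_pair_measure)
    consider "0 < s" "s \<le> 1" | "s < 0" | "1 < s" using s by linarith
    then show "emeasure M ((\<lambda>x. (x, s)) -` ?S) = ennreal (\<phi> s) * indicator {0..1} s"
    proof cases
      case 1
      then have "s \<le> exp (- H x) \<longleftrightarrow> H x \<le> - ln s" for x
        using ln_ge_iff[of s "- H x"] by (metis exp_le_cancel_iff exp_ln le_minus_iff)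
      then show ?thesis unfolding eq using 1 cdf by (simp add: emeasure_eq_measure)
    next
      case 2
      then show ?thesis unfolding eq by simp
    next
      case 3
      have "\<not> s \<le> exp (- H x)" if "x \<in> space M" for x
        using H[OF that] 3 one_le_exp_iff[of "H x"] exp_le_one_iff[of "- H x"] by linarith
      then have "{x \<in> space M. 0 < s \<and> s \<le> exp (- H x)} = {}" by auto
      then show ?thesis unfolding eq by (simp only: emeasure_empty) (use 3 in simp)
    qed
  qed
  also have "\<dots> = ennreal (integral {0..1} \<phi>)"
    by (intro nn_integral_has_integral_lebesgue' nonneg integrable_integral integrable_continuous_real cont)
  finally show ?thesis
    using integral_nonneg[OF integrable_continuous_real[OF cont]] nonneg
    by (subst (asm) ennreal_inj) auto
qed

text \<open>For \<open>0 < s\<close> and \<open>s \<le> 1\<close> the maximum is at most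
  \<open>- ln s\<close> iff \<open>X c \<le> - ln s + g c\<close> for every \<open>c\<close>; the
  entry 0 imposes nothing since \<open>- ln s\<close> is nonnegative. These events are independent,
  and each has probability \<open>1 - s * E exp (- g c)\<close>.\<close>

lemma expectation_exp_neg_Max:
  fixes X g :: "'i \<Rightarrow> 'a \<Rightarrow> real"
  assumes fin: "finite N"
    and X: "\<And>c. c \<in> N \<Longrightarrow> distributed M lborel (X c) (exponential_density 1)"
    and g: "\<And>c x. c \<in> N \<Longrightarrow> x \<in> space M \<Longrightarrow> 0 \<le> g c x"
    and indep_Xg: "\<And>c. c \<in> N \<Longrightarrow> indep_var borel (X c) borel (g c)"
    and indep: "indep_vars (\<lambda>_. borel) (\<lambda>c x. X c x - g c x) N"
  shows "expectation (\<lambda>x. exp (- Max (insert 0 ((\<lambda>c. X c x - g c x) ` N))))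
    = step N (\<lambda>c. expectation (\<lambda>x. exp (- g c x)))"
  unfolding step_def
proof (rule expectation_exp_neg)
  have rv: "(\<lambda>x. X c x - g c x) \<in> borel_measurable M" if "c \<in> N" for c
    using indep that by (simp add: indep_vars_def)
  show "(\<lambda>x. Max (insert 0 ((\<lambda>c. X c x - g c x) ` N))) \<in> borel_measurable M"
  proof (cases "N = {}")
    case False
    have "(\<lambda>x. max 0 (Max ((\<lambda>c. X c x - g c x) ` N))) \<in> borel_measurable M"
      by (intro borel_measurable_max borel_measurable_Max borel_measurable_const fin rv)
    then show ?thesis using False fin by simp
  qed simp
  show "0 \<le> Max (insert 0 ((\<lambda>c. X c x - g c x) ` N))" for x
    using fin by (intro Max_ge) auto
  have mean_le: "expectation (\<lambda>x. exp (- g c x)) \<le> 1" if "c \<in> N" for c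
  proof -
    have [measurable]: "g c \<in> borel_measurable M" using indep_var_rv2[OF indep_Xg[OF that]] .
    have "expectation (\<lambda>x. exp (- g c x)) \<le> expectation (\<lambda>_. 1)"
      using g[OF that] by (intro integral_mono integrable_const_bound[where B=1]) auto
    then show ?thesis by (simp add: prob_space)
  qed
  show "0 \<le> (\<Prod>c\<in>N. 1 - s * expectation (\<lambda>x. exp (- g c x)))" if "s \<in> {0..1}" for s :: real
    using that mean_le by (intro prod_nonneg) (auto intro!: mult_le_one)
  fix s :: real assume s: "0 < s" "s \<le> 1"
  have t: "0 \<le> - ln s" using s by simp
  have single: "prob ((\<lambda>x. X c x - g c x) -` {..- ln s} \<inter> space M) = 1 - s * expectation (\<lambda>x. exp (- g c x))"
    if c: "c \<in> N" for c
  proof -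
    have "indep_var borel (id \<circ> X c) borel ((\<lambda>y. - ln s + y) \<circ> g c)"
      by (rule indep_var_compose[OF indep_Xg[OF c]]) auto
    then have "indep_var borel (X c) borel (\<lambda>x. - ln s + g c x)" by (simp add: comp_def)
    moreover have "0 \<le> - ln s + g c x" if "x \<in> space M" for x
      using g[OF c that] t by linarith
    ultimately have "prob {x \<in> space M. X c x \<le> - ln s + g c x} = 1 - expectation (\<lambda>x. exp (- (- ln s + g c x)))"
      by (rule prob_compare_exponential(3)[OF X[OF c]])
    also have "(\<lambda>x. exp (- (- ln s + g c x))) = (\<lambda>x. s * exp (- g c x))"
      using s by (simp add: exp_diff exp_minus divide_inverse)
    finally show ?thesis by (simp add: vimage_def Int_def conj_commute algebra_simps)
  qed
  show "prob {x \<in> space M. Max (insert 0 ((\<lambda>c. X c x - g c x) ` N)) \<le> - ln s}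
    = (\<Prod>c\<in>N. 1 - s * expectation (\<lambda>x. exp (- g c x)))"
  proof (cases "N = {}")
    case True
    then show ?thesis using t by (simp add: prob_space)
  next
    case False
    have "{x \<in> space M. Max (insert 0 ((\<lambda>c. X c x - g c x) ` N)) \<le> - ln s}
        = (\<Inter>c\<in>N. (\<lambda>x. X c x - g c x) -` {..- ln s} \<inter> space M)"
      using False fin t by auto
    then show ?thesis
      using indep_varsD_finite[OF indep False fin, of "\<lambda>_. {..- ln s}"] single by simp
  qed
qed (intro continuous_intros)

end

section \<open>Means of the truncated recursion on a forest with independent exponential
  weights\<close>

lemma child_degree:
  assumes "finite E" "c \<in> nbrs E v" "card (nbrs E c) \<le> D"
  shows "card (nbrs (avoid E {v}) c) < D"
proof -
  \<comment> \<open>The deleted \<open>v\<close> is itself a neighbour of \<open>c\<close>, which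
    makes the bound strict.\<close>
  have "v \<in> nbrs E c" "v \<notin> nbrs (avoid E {v}) c"
    using assms(2) by (simp_all add: nbrs_def avoid_def insert_commute)
  then have "nbrs (avoid E {v}) c \<subset> nbrs E c"
    using nbrs_mono[OF avoid_subset[of E "{v}"], of c] by blast
  then show ?thesis
    using psubset_card_mono[OF finite_nbrs[OF assms(1)]] assms(3) less_le_trans by blast
qed

lemma avoid_closed:
  assumes "finite E" "two_sets E" "forest E" "E \<subseteq> I"
  shows "finite (avoid E X)" "two_sets (avoid E X)" "forest (avoid E X)" "avoid E X \<subseteq> I"
  using finite_avoid[OF assms(1)] two_sets_avoid[OF assms(2)] forest_avoid[OF assms(3)]
    subset_trans[OF avoid_subset assms(4)] .

locale exp_weights = prob_space M for M :: "'a measure" +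
  fixes w :: "'v set \<Rightarrow> 'a \<Rightarrow> real" and I :: "'v set set"
  assumes indep: "indep_vars (\<lambda>_. borel) w I"
    and exp_dist: "\<And>f. f \<in> I \<Longrightarrow> distributed M lborel (w f) (exponential_density 1)"
begin

text \<open>The equations with \<open>restrict\<close> say that each functional reads only the
  coordinates in its own block; disjoint blocks then give independence.\<close>

lemma indep_functionals:
  fixes F H :: "('v set \<Rightarrow> real) \<Rightarrow> real"
  assumes "A \<inter> B = {}" "A \<subseteq> I" "B \<subseteq> I"
    and "F \<in> borel_measurable (Pi\<^sub>M A (\<lambda>_. borel))" "\<And>W. F (restrict W A) = F W"
    and "H \<in> borel_measurable (Pi\<^sub>M B (\<lambda>_. borel))" "\<And>W. H (restrict W B) = H W"
  shows "indep_var borel (\<lambda>x. F (\<lambda>f. w f x)) borel (\<lambda>x. H (\<lambda>f. w f x))"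
  using indep_var_compose[OF indep_var_restrict[OF indep assms(1-3)] assms(4,6)]
  by (simp add: comp_def assms(5,7))

text \<open>Stated for any nonnegative \<open>g\<close> local to the child branches, so that it
  covers both a recursive level and the cut with \<open>g = 0\<close>.\<close>

lemma expectation_exp_excess:
  fixes g :: "('v set \<Rightarrow> real) \<Rightarrow> 'v \<Rightarrow> real"
  assumes E: "finite E" "two_sets E" "forest E" "E \<subseteq> I"
    and g_meas: "\<And>c. c \<in> nbrs E v \<Longrightarrow> (\<lambda>W. g W c) \<in> borel_measurable (Pi\<^sub>M (branch (avoid E {v}) c) (\<lambda>_. borel))"
    and g_local: "\<And>c W. c \<in> nbrs E v \<Longrightarrow> g (restrict W (branch (avoid E {v}) c)) c = g W c"
    and g_nonneg: "\<And>c W. c \<in> nbrs E v \<Longrightarrow> 0 \<le> g W c"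
  shows "expectation (\<lambda>x. exp (- excess (\<lambda>f. w f x) E v (g (\<lambda>f. w f x))))
    = step (nbrs E v) (\<lambda>c. expectation (\<lambda>x. exp (- g (\<lambda>f. w f x) c)))"
  unfolding excess_def
proof (rule expectation_exp_neg_Max)
  let ?B = "\<lambda>c. branch (avoid E {v}) c"
  let ?K = "\<lambda>c. insert {v, c} (?B c)"
  have edge: "{v, c} \<in> I" if "c \<in> nbrs E v" for c
    using that E(4) by (auto simp: nbrs_def)
  have B_sub: "?B c \<subseteq> I" for c
    by (rule subset_trans[OF branch_subset avoid_closed(4)[OF E]])
  show "distributed M lborel (w {v, c}) (exponential_density 1)" if "c \<in> nbrs E v" for c
    using edge[OF that] by (rule exp_dist)
  show "indep_var borel (w {v, c}) borel (\<lambda>x. g (\<lambda>f. w f x) c)" if c: "c \<in> nbrs E v" for c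
  proof (rule indep_functionals[where F = "\<lambda>W. W {v, c}" and A = "{{v, c}}"])
    show "{{v, c}} \<inter> ?B c = {}" by (auto simp: branch_def avoid_def)
    show "(\<lambda>W. g W c) \<in> borel_measurable (Pi\<^sub>M (?B c) (\<lambda>_. borel))"
      "g (restrict W (?B c)) c = g W c" for W
      by (rule g_meas[OF c] g_local[OF c])+
    show "(\<lambda>W. W {v, c}) \<in> borel_measurable (Pi\<^sub>M {{v, c}} (\<lambda>_. borel :: real measure))"
      by (rule measurable_component_singleton) simp
  qed (use edge[OF c] B_sub in simp_all)
  \<comment> \<open>One block per child, consisting of the edge to the child and the branch at the
    child. The blocks are pairwise disjoint, so the differences formed from them are
    independent.\<close>
  have "indep_vars (\<lambda>c. Pi\<^sub>M (?K c) (\<lambda>_. borel)) (\<lambda>c x. restrict (\<lambda>f. w f x) (?K c)) (nbrs E v)"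
    using edge B_sub by (intro indep_vars_restrict[OF indep] child_branches_disjoint E) auto
  then have "indep_vars (\<lambda>_. borel) (\<lambda>c x. (\<lambda>W. W {v, c} - g W c) (restrict (\<lambda>f. w f x) (?K c))) (nbrs E v)"
  proof (rule indep_vars_compose2)
    fix c assume c: "c \<in> nbrs E v"
    have "(\<lambda>W. g (restrict W (?B c)) c) \<in> borel_measurable (Pi\<^sub>M (?K c) (\<lambda>_. borel))"
      by (rule measurable_compose[OF measurable_restrict_subset g_meas[OF c]]) auto
    then show "(\<lambda>W. W {v, c} - g W c) \<in> borel_measurable (Pi\<^sub>M (?K c) (\<lambda>_. borel))"
      by (intro borel_measurable_diff measurable_component_singleton) (auto simp: g_local[OF c])
  qed
  also have "?this \<longleftrightarrow> indep_vars (\<lambda>_. borel) (\<lambda>c x. w {v, c} x - g (\<lambda>f. w f x) c) (nbrs E v)"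
  proof (intro indep_vars_cong refl ext)
    fix c x assume c: "c \<in> nbrs E v"
    have "g (restrict (\<lambda>f. w f x) (?K c)) c = g (restrict (restrict (\<lambda>f. w f x) (?K c)) (?B c)) c"
      by (rule g_local[OF c, symmetric])
    also have "restrict (restrict (\<lambda>f. w f x) (?K c)) (?B c) = restrict (\<lambda>f. w f x) (?B c)"
      by (auto simp: restrict_def)
    also have "g (restrict (\<lambda>f. w f x) (?B c)) c = g (\<lambda>f. w f x) c" by (rule g_local[OF c])
    finally have eq: "g (restrict (\<lambda>f. w f x) (?K c)) c = g (\<lambda>f. w f x) c" .
    show "(restrict (\<lambda>f. w f x) (?K c)) {v, c} - g (restrict (\<lambda>f. w f x) (?K c)) c
        = w {v, c} x - g (\<lambda>f. w f x) c"
      unfolding eq by simp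
  qed
  finally show "indep_vars (\<lambda>_. borel) (\<lambda>c x. w {v, c} x - g (\<lambda>f. w f x) c) (nbrs E v)" .
qed (use E g_nonneg in auto)

text \<open>As \<open>exp (- x)\<close> decreases in \<open>x\<close>, \<open>mean False\<close> is
  the larger of the two.\<close>

definition mean :: "bool \<Rightarrow> nat \<Rightarrow> 'v set set \<Rightarrow> 'v \<Rightarrow> real" where
  "mean b k E v = expectation (\<lambda>x. exp (- msg (\<lambda>f. w f x) b k E v))"

lemma msg_restrict_branch: "msg (restrict W (branch E v)) b k E v = msg W b k E v"
  by (rule msg_cong) simp

lemma msg_measurable_branch:
  "finite E \<Longrightarrow> (\<lambda>W. msg W b k E v) \<in> borel_measurable (Pi\<^sub>M (branch E v) (\<lambda>_. borel))"
  by (intro msg_measurable measurable_component_singleton)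

lemma msg_random_variable:
  assumes "finite E" "E \<subseteq> I"
  shows "(\<lambda>x. msg (\<lambda>f. w f x) b k E v) \<in> borel_measurable M"
proof (rule msg_measurable[OF assms(1)])
  fix f assume "f \<in> branch E v"
  then have "f \<in> I" using branch_subset[of E v] assms(2) by blast
  then show "w f \<in> borel_measurable M" using exp_dist distributed_measurable by fastforce
qed

lemma integrable_exp_msg:
  assumes "finite E" "E \<subseteq> I"
  shows "integrable M (\<lambda>x. exp (- msg (\<lambda>f. w f x) b k E v))"
proof (rule integrable_const_bound[where B=1])
  show "AE x in M. norm (exp (- msg (\<lambda>f. w f x) b k E v)) \<le> 1"
    by (rule AE_I2) (simp add: msg_nonneg assms)
  note msg_random_variable[OF assms, measurable]
  show "(\<lambda>x. exp (- msg (\<lambda>f. w f x) b k E v)) \<in> borel_measurable M" by measurable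
qed

lemma mean_nonneg: "0 \<le> mean b k E v"
  by (simp add: mean_def)

lemma mean_le_1:
  assumes "finite E" "E \<subseteq> I" shows "mean b k E v \<le> 1"
proof -
  have "mean b k E v \<le> expectation (\<lambda>_. 1)"
    unfolding mean_def using assms
    by (intro integral_mono integrable_exp_msg) (auto simp: msg_nonneg)
  then show ?thesis by (simp add: prob_space)
qed

lemma mean_True_le_False:
  assumes "finite E" "E \<subseteq> I" shows "mean True k E v \<le> mean False k E v"
  unfolding mean_def using assms
  by (intro integral_mono integrable_exp_msg) (auto simp: msg_mono)

lemma mean_Suc:
  assumes E: "finite E" "two_sets E" "forest E" "E \<subseteq> I"
  shows "mean b (Suc k) E v = step (nbrs E v) (mean (\<not> b) k (avoid E {v}))"
  unfolding mean_def msg.simps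
  using expectation_exp_excess[OF E, of v "\<lambda>W. msg W (\<not> b) k (avoid E {v})"] E
  by (simp add: msg_measurable_branch msg_restrict_branch msg_nonneg)

lemma mean_0:
  assumes E: "finite E" "two_sets E" "forest E" "E \<subseteq> I"
  shows "mean b 0 E v = (if b then step (nbrs E v) (\<lambda>_. 1) else 1)"
  unfolding mean_def msg.simps
  using expectation_exp_excess[OF E, of v "\<lambda>W c. 0"] by (simp add: prob_space)

text \<open>With nothing to match, either truncation is 0. This is the case
  \<open>p c = q c = 1\<close> of \<open>step_contraction\<close>.\<close>

lemma mean_no_nbrs:
  assumes E: "finite E" "two_sets E" "forest E" "E \<subseteq> I" and "nbrs E v = {}"
  shows "mean b k E v = 1"
  using assms(5) by (cases k) (simp_all add: mean_0[OF E] mean_Suc[OF E])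

lemma mean_ge:
  assumes E: "finite E" "two_sets E" "forest E" "E \<subseteq> I" and deg: "card (nbrs E v) < D"
  shows "1 / real D \<le> mean b k E v"
proof -
  have "1 / real D \<le> 1 / (real (card (nbrs E v)) + 1)"
    using deg by (intro divide_left_mono) auto
  also have "\<dots> \<le> mean b k E v"
  proof (cases k)
    case 0
    then show ?thesis using step_ge[of "nbrs E v" "\<lambda>_. 1"] by (auto simp: mean_0[OF E])
  next
    case (Suc j)
    have "mean (\<not> b) j (avoid E {v}) c \<le> 1" for c
      by (intro mean_le_1 avoid_closed[OF E])
    then show ?thesis by (simp add: Suc mean_Suc[OF E] step_ge)
  qed
  finally show ?thesis .
qed

text \<open>The child \<open>c\<close> has mean at least \<open>1 / real D\<close> by
  \<open>mean_ge\<close>, and \<open>step_le\<close> applies. At depth 0 the lower truncation has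
  mean 1 even at vertices with neighbours, hence the depth \<open>Suc k\<close>.\<close>

lemma mean_Suc_le:
  assumes E: "finite E" "two_sets E" "forest E" "E \<subseteq> I"
    and deg: "\<And>x. card (nbrs E x) \<le> D" and c: "c \<in> nbrs E v"
  shows "mean b (Suc k) E v \<le> 1 - 1 / (2 * real D)"
proof -
  have E': "finite (avoid E {v})" "two_sets (avoid E {v})" "forest (avoid E {v})" "avoid E {v} \<subseteq> I"
    by (rule avoid_closed[OF E])+
  have "mean b (Suc k) E v \<le> 1 - (1 / real D) / 2"
    unfolding mean_Suc[OF E]
    using mean_ge[OF E' child_degree[OF E(1) c deg]]
    by (intro step_le[OF _ c] mean_nonneg mean_le_1 E') (auto simp: E)
  then show ?thesis by simp
qed

text \<open>The ratio starts at most at \<open>D\<close>, since the means lie between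
  \<open>1 / real D\<close> and 1, and each level contracts its bound towards 1. The start is at
  depth 1 because the dichotomy required by \<open>step_contraction\<close> may fail at depth
  0.\<close>

lemma mean_ratio:
  assumes "finite E" "two_sets E" "forest E" "E \<subseteq> I"
    and "\<And>x. card (nbrs E x) \<le> D" and "card (nbrs E v) < D"
  shows "mean False (Suc k) E v
    \<le> (1 + (real D - 1) * (1 - 1 / (2 * real D) ^ D) ^ k) * mean True (Suc k) E v"
  using assms
proof (induction k arbitrary: E v)
  case 0
  have "0 < real D" using 0(6) by simp
  then have "1 \<le> real D * mean True (Suc 0) E v"
    using mean_ge[OF 0(1-4,6), of True "Suc 0"] by (simp add: field_simps)
  then show ?case using mean_le_1[OF 0(1,4), of False "Suc 0" v] by simp
next
  case (Suc k)
  note E = Suc.prems(1-4)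
  let ?E = "avoid E {v}"
  define R where "R = 1 + (real D - 1) * (1 - 1 / (2 * real D) ^ D) ^ k"
  have E': "finite ?E" "two_sets ?E" "forest ?E" "?E \<subseteq> I"
    by (rule avoid_closed[OF E])+
  have D: "1 \<le> real D" using Suc.prems(6) by simp
  have eps: "1 / (2 * real D) ^ D \<le> 1"
    using one_le_power[of "2 * real D" D] D by (subst divide_le_eq_1_pos) simp_all
  have deg: "card (nbrs ?E x) \<le> D" for x
    using card_mono[OF finite_nbrs[OF Suc.prems(1)] nbrs_mono[OF avoid_subset], of "{v}" x]
      Suc.prems(5)[of x] by linarith
  \<comment> \<open>The truncation flips at the children, so \<open>mean True\<close> enters there
    as \<open>q\<close> and \<open>mean False\<close> as \<open>p\<close>.\<close>
  have "step (nbrs E v) (mean True (Suc k) ?E)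
      \<le> (1 + (R - 1) * (1 - 1 / (2 * real D) ^ D)) * step (nbrs E v) (mean False (Suc k) ?E)"
  proof (rule step_contraction)
    show "1 \<le> R" using D eps by (simp add: R_def)
    fix c assume c: "c \<in> nbrs E v"
    show "mean False (Suc k) ?E c \<le> R * mean True (Suc k) ?E c"
      unfolding R_def
      by (rule Suc.IH[OF E' deg child_degree[OF E(1) c Suc.prems(5)]])
    show "mean False (Suc k) ?E c = 1 \<and> mean True (Suc k) ?E c = 1
        \<or> mean False (Suc k) ?E c \<le> 1 - 1 / (2 * real D)"
      using mean_no_nbrs[OF E'] mean_Suc_le[OF E' deg] by blast
  qed (use E Suc.prems(6) mean_nonneg mean_le_1[OF E'(1,4)] in auto)
  then show ?case
    unfolding mean_Suc[OF E, of _ "Suc k"] by (simp add: R_def mult_ac)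
qed

text \<open>The event contains every outcome in which the truncations do not settle the comparison
  of the edge weight with the gains. Its probability is a difference of two products of means, one
  factor for each side of the edge, and \<open>mean_ratio\<close> bounds the contribution of each
  side.\<close>

lemma prob_undetermined_le:
  fixes u v :: 'v and D k :: nat
  assumes E: "finite E" "two_sets E" "forest E" "E \<subseteq> I"
    and deg: "\<And>x. card (nbrs E x) \<le> D" and uv: "{u, v} \<in> E"
  defines "K \<equiv> E - {{u, v}}"
  defines "m \<equiv> \<lambda>b x. msg (\<lambda>f. w f x) b (Suc k) K u + msg (\<lambda>f. w f x) b (Suc k) (avoid K {u}) v"
  shows "{x \<in> space M. m False x \<le> w {u, v} x \<and> w {u, v} x \<le> m True x} \<in> events" (is ?meas)
    and "prob {x \<in> space M. m False x \<le> w {u, v} x \<and> w {u, v} x \<le> m True x}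
      \<le> 2 * (real D - 1) * (1 - 1 / (2 * real D) ^ D) ^ k" (is ?le)
proof -
  let ?K = "avoid K {u}"
  have K: "finite K" "two_sets K" "forest K" "K \<subseteq> I"
    using E forest_subset[OF E(3), of K] by (auto simp: K_def)
  have K': "finite ?K" "two_sets ?K" "forest ?K" "?K \<subseteq> I"
    by (rule avoid_closed[OF K])+
  have KE: "K \<subseteq> E" by (auto simp: K_def)
  have degK: "card (nbrs F x) \<le> D" if "F \<subseteq> K" for F x
    using card_mono[OF finite_nbrs[OF E(1)] nbrs_mono[OF subset_trans[OF that KE]], of x] deg[of x]
    by linarith
  \<comment> \<open>Removing the edge \<open>{u, v}\<close> lowers the degree of both endpoints,
    which provides the strict bounds that \<open>mean_ratio\<close> asks for.\<close>
  have endpoint: "card (nbrs K x) < D" if xy: "{x, y} = {u, v}" for x y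
  proof -
    have "y \<in> nbrs E x" "y \<notin> nbrs K x"
      using xy uv by (simp_all add: nbrs_def K_def)
    then have "nbrs K x \<subset> nbrs E x" using nbrs_mono[OF KE, of x] by blast
    then show ?thesis using psubset_card_mono[OF finite_nbrs[OF E(1)]] deg[of x] less_le_trans by blast
  qed
  have du: "card (nbrs K u) < D" using endpoint[of u v] by simp
  have dv: "card (nbrs ?K v) < D"
    using endpoint[of v u] card_mono[OF finite_nbrs[OF K(1)] nbrs_mono[OF avoid_subset], of "{u}" v]
    by (simp add: insert_commute)
  \<comment> \<open>The edge is a bridge, so its two sides read disjoint sets of weights.\<close>
  have "v \<notin> reach K u" using E(3) uv by (auto simp: forest_def reach_def K_def)
  then have disj: "branch K u \<inter> branch ?K v = {}"
    by (rule branch_disjoint[OF K(2) _ avoid_subset])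
  have sub: "branch K u \<subseteq> I" "branch ?K v \<subseteq> I"
    by (rule subset_trans[OF branch_subset K(4)] subset_trans[OF branch_subset K'(4)])+
  have wI: "{u, v} \<in> I" using uv E(4) by auto
  have m_rv [measurable]: "m b \<in> borel_measurable M" for b
    unfolding m_def using K K' by (intro borel_measurable_add msg_random_variable) auto
  have w_rv [measurable]: "w {u, v} \<in> borel_measurable M"
    using exp_dist[OF wI] distributed_measurable by fastforce
  show ?meas by measurable
  have m_nonneg: "0 \<le> m b x" for b x
    unfolding m_def using K K' by (intro add_nonneg_nonneg msg_nonneg) auto
  have m_mono: "m False x \<le> m True x" for x
    unfolding m_def using K K' by (intro add_mono msg_mono) auto
  have indep_m: "indep_var borel (w {u, v}) borel (m b)" for b
    unfolding m_def
  proof (rule indep_functionals[where F = "\<lambda>W. W {u, v}" and A = "{{u, v}}"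
        and B = "branch K u \<union> branch ?K v"
        and H = "\<lambda>W. msg W b (Suc k) K u + msg W b (Suc k) ?K v"])
    let ?J = "branch K u \<union> branch ?K v"
    show "{{u, v}} \<inter> ?J = {}"
      by (auto simp: branch_def avoid_def K_def)
    show "(\<lambda>W. msg W b (Suc k) K u + msg W b (Suc k) ?K v) \<in> borel_measurable (Pi\<^sub>M ?J (\<lambda>_. borel))"
      using K K' by (intro borel_measurable_add msg_measurable measurable_component_singleton) auto
    show "msg (restrict W ?J) b (Suc k) K u + msg (restrict W ?J) b (Suc k) ?K v
        = msg W b (Suc k) K u + msg W b (Suc k) ?K v" for W
      by (intro arg_cong2[where f="(+)"] msg_cong) auto
    show "(\<lambda>W. W {u, v}) \<in> borel_measurable (Pi\<^sub>M {{u, v}} (\<lambda>_. borel :: real measure))"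
      by (rule measurable_component_singleton) simp
  qed (use wI sub in simp_all)
  have prod: "expectation (\<lambda>x. exp (- m b x)) = mean b (Suc k) K u * mean b (Suc k) ?K v" for b
  proof -
    have "indep_var borel (\<lambda>x. msg (\<lambda>f. w f x) b (Suc k) K u) borel (\<lambda>x. msg (\<lambda>f. w f x) b (Suc k) ?K v)"
      by (rule indep_functionals[OF disj sub msg_measurable_branch[OF K(1)] msg_restrict_branch
            msg_measurable_branch[OF K'(1)] msg_restrict_branch])
    then have "indep_var borel ((\<lambda>y. exp (- y)) \<circ> (\<lambda>x. msg (\<lambda>f. w f x) b (Suc k) K u))
        borel ((\<lambda>y. exp (- y)) \<circ> (\<lambda>x. msg (\<lambda>f. w f x) b (Suc k) ?K v))"
      by (rule indep_var_compose) auto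
    then have "expectation (\<lambda>x. exp (- msg (\<lambda>f. w f x) b (Suc k) K u) * exp (- msg (\<lambda>f. w f x) b (Suc k) ?K v))
        = mean b (Suc k) K u * mean b (Suc k) ?K v"
      unfolding mean_def comp_def using K K'
      by (intro indep_var_lebesgue_integral integrable_exp_msg) auto
    then show ?thesis by (simp add: m_def exp_add exp_diff exp_minus divide_inverse)
  qed
  \<comment> \<open>The subtracted event is contained in the other one because
    \<open>m False x \<le> m True x\<close>, and \<open>prob_compare_exponential\<close> evaluates
    both.\<close>
  have "prob {x \<in> space M. m False x \<le> w {u, v} x \<and> w {u, v} x \<le> m True x}
      = prob ({x \<in> space M. m False x \<le> w {u, v} x} - {x \<in> space M. m True x < w {u, v} x})"
    by (intro arg_cong[where f=prob]) auto
  also have "\<dots> = prob {x \<in> space M. m False x \<le> w {u, v} x} - prob {x \<in> space M. m True x < w {u, v} x}"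
    using m_mono by (intro finite_measure_Diff) (auto intro: order_trans less_imp_le)
  also have "\<dots> = mean False (Suc k) K u * mean False (Suc k) ?K v - mean True (Suc k) K u * mean True (Suc k) ?K v"
    using prob_compare_exponential(1)[OF exp_dist[OF wI] indep_m m_nonneg]
      prob_compare_exponential(2)[OF exp_dist[OF wI] indep_m m_nonneg] by (simp add: prod)
  also have "\<dots> \<le> 2 * (real D - 1) * (1 - 1 / (2 * real D) ^ D) ^ k"
  proof -
    define t where "t = (real D - 1) * (1 - 1 / (2 * real D) ^ D) ^ k"
    have D: "1 \<le> real D" using du by simp
    have "1 / (2 * real D) ^ D \<le> 1"
      using one_le_power[of "2 * real D" D] D by (subst divide_le_eq_1_pos) simp_all
    then have t: "0 \<le> t" using D by (simp add: t_def)
    have diff: "mean False (Suc k) F y - mean True (Suc k) F y \<le> t"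
      "0 \<le> mean False (Suc k) F y - mean True (Suc k) F y"
      if F: "finite F" "two_sets F" "forest F" "F \<subseteq> I" "F \<subseteq> K" "card (nbrs F y) < D" for F y
    proof -
      have "mean False (Suc k) F y \<le> (1 + t) * mean True (Suc k) F y"
        unfolding t_def using mean_ratio[OF F(1-4) degK[OF F(5)] F(6)] .
      moreover have "t * mean True (Suc k) F y \<le> t * 1"
        using t by (intro mult_left_mono mean_le_1 F)
      ultimately show "mean False (Suc k) F y - mean True (Suc k) F y \<le> t"
        by (simp add: algebra_simps)
      show "0 \<le> mean False (Suc k) F y - mean True (Suc k) F y"
        using mean_True_le_False[OF F(1,4)] by simp
    qed
    \<comment> \<open>The difference of products is split as
      \<open>a * b - a' * b' = a * (b - b') + (a - a') * b'\<close>; all means are at most 1 and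
      both differences at most \<open>t\<close>.\<close>
    have a: "mean False (Suc k) K u * (mean False (Suc k) ?K v - mean True (Suc k) ?K v) \<le> 1 * t"
      using t by (intro mult_mono diff mean_le_1 K K' dv avoid_subset mean_nonneg) auto
    have b: "(mean False (Suc k) K u - mean True (Suc k) K u) * mean True (Suc k) ?K v \<le> t * 1"
      using t by (intro mult_mono diff mean_le_1 K K' du subset_refl mean_nonneg) auto
    show ?thesis using a b by (simp add: t_def algebra_simps)
  qed
  finally show ?le .
qed

end

section \<open>Balls in graphs\<close>

text \<open>Loops are cut as they appear: if the walk returns to a vertex of the path, the path is
  truncated there.\<close>

lemma rtrancl_arcs_path:
  assumes "(a, b) \<in> (arcs F)\<^sup>*"
  shows "\<exists>p. p \<noteq> [] \<and> hd p = a \<and> last p = b \<and> distinct p \<and> successively (\<lambda>x y. {x, y} \<in> F) p"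
  using assms
proof (induction rule: rtrancl_induct)
  case base
  show ?case by (rule exI[of _ "[a]"]) simp
next
  case (step y z)
  then obtain p where p: "p \<noteq> []" "hd p = a" "last p = y" "distinct p"
    "successively (\<lambda>x y. {x, y} \<in> F) p" by blast
  show ?case
  proof (cases "z \<in> set p")
    case True
    then obtain p1 p2 where s: "p = p1 @ z # p2" by (meson split_list)
    have "hd (p1 @ [z]) = a" using p(2) s by (cases p1) auto
    then show ?thesis
      using p s by (intro exI[of _ "p1 @ [z]"]) (auto simp: successively_append_iff)
  next
    case False
    have "{y, z} \<in> F" using step(2) by (simp add: arcs_def)
    then show ?thesis
      using p False by (intro exI[of _ "p @ [z]"]) (auto simp: successively_append_iff)
  qed
qed

lemma simple_graph_edge_verts: "simple_graph G \<Longrightarrow> {x, y} \<in> edges G \<Longrightarrow> x \<in> verts G \<and> y \<in> verts G \<and> x \<noteq> y"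
  unfolding simple_graph_def by (metis doubleton_eq_iff)

lemma simple_graph_induced: "simple_graph G \<Longrightarrow> simple_graph (induced G S)"
  unfolding simple_graph_def induced_def by fastforce

lemma simple_graph_two_sets: "simple_graph G \<Longrightarrow> two_sets (edges G)"
  unfolding simple_graph_def by (metis card_2_iff)

text \<open>A simple path from \<open>a\<close> to \<open>b\<close> that avoids the edge
  \<open>{a, b}\<close> is closed to a cycle by this edge.\<close>

lemma acyclic_forest:
  assumes simple: "simple_graph H" and acyclic: "\<nexists>p. cycle H p"
  shows "forest (edges H)"
  unfolding forest_def
proof (intro allI impI notI)
  fix a b assume ab: "{a, b} \<in> edges H" and "(a, b) \<in> (arcs (edges H - {{a, b}}))\<^sup>*"
  then obtain p where p: "p \<noteq> []" "hd p = a" "last p = b" "distinct p"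
    and succ: "successively (\<lambda>x y. {x, y} \<in> edges H - {{a, b}}) p"
    using rtrancl_arcs_path by metis
  have ne: "a \<noteq> b" using simple_graph_edge_verts[OF simple ab] by simp
  \<comment> \<open>A single vertex would force \<open>a = b\<close>, and two vertices would use the
    excluded edge.\<close>
  have len: "length p \<ge> 3"
  proof (rule ccontr)
    assume "\<not> length p \<ge> 3"
    then consider x where "p = [x]" | x y where "p = [x, y]"
      using p(1) by (cases p; cases "tl p"; cases "tl (tl p)") auto
    then show False using p(2,3) ne succ by cases auto
  qed
  have adj: "successively (adj H) p"
    using succ by (rule successively_mono) (auto simp: adj_def)
  have "set p \<subseteq> verts H"
  proof
    fix x assume "x \<in> set p"
    then obtain i where i: "i < length p" "x = p ! i" by (metis in_set_conv_nth)
    have edge: "{p ! j, p ! Suc j} \<in> edges H" if "Suc j < length p" for j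
      using adj that by (auto simp: successively_conv_nth adj_def)
    show "x \<in> verts H"
    proof (cases i)
      case 0
      then show ?thesis using i edge[of 0] len simple_graph_edge_verts[OF simple] by auto
    next
      case (Suc j)
      then show ?thesis using i edge[of j] simple_graph_edge_verts[OF simple] by auto
    qed
  qed
  then have "cycle H p"
    using p adj len ab by (simp add: cycle_def walk_def adj_def insert_commute)
  then show False using acyclic by blast
qed

section \<open>Distances, balls and boundaries in terms of walk lengths\<close>

lemma walk_relpow:
  assumes "walk G p" shows "(hd p, last p) \<in> arcs (edges G) ^^ (length p - 1)"
  using assms
proof (induction p rule: induct_list012)
  case (3 x y zs)
  then have "(y, last (y # zs)) \<in> arcs (edges G) ^^ length zs" by (simp add: walk_def)
  moreover have "(x, y) \<in> arcs (edges G)" using 3 by (simp add: walk_def adj_def arcs_def)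
  ultimately have "(x, last (y # zs)) \<in> arcs (edges G) ^^ Suc (length zs)" by (rule relpow_Suc_I2[rotated])
  then show ?case by simp
qed (auto simp: walk_def)

lemma relpow_walk:
  assumes "simple_graph G" "x \<in> verts G" "(x, y) \<in> arcs (edges G) ^^ j"
  shows "\<exists>p. walk_betw G x p y \<and> length p = Suc j"
  using assms(2,3)
proof (induction j arbitrary: x)
  case 0
  then show ?case by (intro exI[of _ "[x]"]) (simp add: walk_betw_def walk_def)
next
  case (Suc j)
  obtain z where "(x, z) \<in> arcs (edges G)" and zy: "(z, y) \<in> arcs (edges G) ^^ j"
    using relpow_Suc_D2[OF Suc.prems(2)] by blast
  then have z: "{x, z} \<in> edges G" by (simp add: arcs_def)
  then have "z \<in> verts G" using simple_graph_edge_verts[OF assms(1)] by blast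
  then obtain p where "walk_betw G z p y" "length p = Suc j" using Suc.IH zy by blast
  then show ?case
    using z Suc.prems(1)
    by (intro exI[of _ "x # p"], cases p) (auto simp: walk_betw_def walk_def adj_def)
qed

lemma graph_dist_le_iff:
  assumes "simple_graph G" "x \<in> verts G"
  shows "graph_dist G x y \<le> enat r \<longleftrightarrow> (\<exists>j\<le>r. (x, y) \<in> arcs (edges G) ^^ j)"
proof
  let ?L = "(\<lambda>p. enat (length p - 1)) ` {p. walk_betw G x p y}"
  assume le: "graph_dist G x y \<le> enat r"
  \<comment> \<open>For a nonempty set of extended naturals the infimum is attained, here by a walk;
    the empty infimum would be \<open>\<infinity>\<close>.\<close>
  have "?L \<noteq> {}"
  proof
    assume "?L = {}"
    then have "graph_dist G x y = Inf {}" by (simp only: graph_dist_def)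
    then have "graph_dist G x y = \<infinity>" by (simp add: Inf_enat_def)
    then show False using le by simp
  qed
  then have "Inf ?L \<in> ?L" unfolding Inf_enat_def by (auto intro: LeastI)
  then obtain p where "walk_betw G x p y" "graph_dist G x y = enat (length p - 1)"
    by (auto simp: graph_dist_def)
  then show "\<exists>j\<le>r. (x, y) \<in> arcs (edges G) ^^ j"
    using walk_relpow[of G p] le by (auto simp: walk_betw_def)
next
  assume "\<exists>j\<le>r. (x, y) \<in> arcs (edges G) ^^ j"
  then obtain j p where "j \<le> r" "walk_betw G x p y" "length p = Suc j"
    using relpow_walk[OF assms] by blast
  then have "graph_dist G x y \<le> enat (length p - 1)"
    unfolding graph_dist_def by (intro INF_lower) simp
  also have "\<dots> \<le> enat r" using \<open>length p = Suc j\<close> \<open>j \<le> r\<close> by simp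
  finally show "graph_dist G x y \<le> enat r" .
qed

lemma nbrs_edges_degree:
  assumes "simple_graph G" "degrees_le G D"
  shows "finite (nbrs (edges G) x)" "card (nbrs (edges G) x) \<le> D"
proof -
  have "nbrs (edges G) x \<subseteq> neighbours G x"
    using simple_graph_edge_verts[OF assms(1)] by (auto simp: nbrs_def neighbours_def adj_def)
  moreover have "nbrs (edges G) x = {}" if "x \<notin> verts G"
    using that simple_graph_edge_verts[OF assms(1)] by (auto simp: nbrs_def)
  ultimately show "finite (nbrs (edges G) x)" "card (nbrs (edges G) x) \<le> D"
    using assms(2) unfolding degrees_le_def
    by (metis card.empty finite.emptyI finite_subset zero_le, metis card.empty card_mono le_trans zero_le)
qed

lemma finite_relpow_image:
  assumes "\<And>x. finite (nbrs E x)"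
  shows "finite {y. (x, y) \<in> arcs E ^^ j}"
proof (induction j)
  case (Suc j)
  have "{y. (x, y) \<in> arcs E ^^ Suc j} \<subseteq> (\<Union>z\<in>{y. (x, y) \<in> arcs E ^^ j}. nbrs E z)"
    by (auto simp: arcs_def nbrs_def)
  moreover have "finite (\<Union>z\<in>{y. (x, y) \<in> arcs E ^^ j}. nbrs E z)"
    by (intro finite_UN_I Suc assms)
  ultimately show ?case by (rule finite_subset)
qed simp

lemma edge_ball_verts:
  assumes "simple_graph G" "e \<in> edges G"
  shows "y \<in> verts (edge_ball G e r) \<longleftrightarrow> y \<in> verts G \<and> (\<exists>u\<in>e. \<exists>j\<le>r. (u, y) \<in> arcs (edges G) ^^ j)"
proof -
  have "e \<subseteq> verts G" using assms by (auto simp: simple_graph_def)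
  then have "graph_dist G u y \<le> enat r \<longleftrightarrow> (\<exists>j\<le>r. (u, y) \<in> arcs (edges G) ^^ j)" if "u \<in> e" for u
    using that by (intro graph_dist_le_iff[OF assms(1)]) auto
  then show ?thesis by (simp add: edge_ball_def induced_def cong: bex_cong_simp)
qed

lemma finite_edge_ball:
  assumes "simple_graph G" "degrees_le G D" "e \<in> edges G"
  shows "finite (verts (edge_ball G e r))" "finite (edges (edge_ball G e r))"
proof -
  have "card e = 2" using simple_graph_two_sets[OF assms(1)] assms(3) by blast
  then have "finite e" using card.infinite by fastforce
  then have "finite (\<Union>u\<in>e. \<Union>j\<in>{..r}. {y. (u, y) \<in> arcs (edges G) ^^ j})"
    by (intro finite_UN_I finite_relpow_image nbrs_edges_degree(1)[OF assms(1,2)] finite_atMost)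
  then show fin: "finite (verts (edge_ball G e r))"
    by (rule finite_subset[rotated]) (use edge_ball_verts[OF assms(1,3)] in blast)
  have "edges (edge_ball G e r) \<subseteq> Pow (verts (edge_ball G e r))"
    using assms(1) unfolding simple_graph_def edge_ball_def induced_def by fastforce
  then show "finite (edges (edge_ball G e r))" using fin by (simp add: finite_subset)
qed

text \<open>A neighbour of \<open>y\<close> is reached in \<open>j + 1 \<le> r\<close> steps and
  hence still lies in the ball.\<close>

lemma boundary_far:
  assumes simple: "simple_graph G" and e: "e \<in> edges G" "u \<in> e"
    and walk: "(u, y) \<in> arcs (edges G) ^^ j" "j < r"
  shows "y \<notin> boundary G (edge_ball G e r)"
proof
  assume "y \<in> boundary G (edge_ball G e r)"
  then obtain z where z: "z \<in> verts G" "z \<notin> verts (edge_ball G e r)" "{y, z} \<in> edges G"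
    by (auto simp: boundary_def adj_def)
  have "(u, z) \<in> arcs (edges G) ^^ Suc j" using walk(1) z(3) by (auto simp: arcs_def)
  then show False
    using z walk(2) e(2) Suc_leI unfolding edge_ball_verts[OF simple e(1)] by blast
qed

theorem theorem1p3:
  fixes G :: "'a ugraph" and D r :: nat and e :: "'a set"
    and P :: "'b measure" and w :: "'a set \<Rightarrow> 'b \<Rightarrow> real"
  assumes "D \<ge> 1"
    and "simple_graph G" and "connected_graph G" and "degrees_le G D"
    and "prob_space P"
    and "prob_space.indep_vars P (\<lambda>_. borel) w (edges G)"
    and "\<And>f. f \<in> edges G \<Longrightarrow> distributed P lborel (w f) (exponential_density 1)"
    and "e \<in> edges G" and "r \<ge> 3"
    and "tree (edge_ball G e r)"
  shows "varrho P w r G e \<le> 2 * real D * (1 - (2 * real D) powi (- int D)) ^ (r - 2)"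
proof -
  interpret exp_weights P w "edges G"
    using assms(5-7) by (simp add: exp_weights_def exp_weights_axioms_def)
  define B where "B = edge_ball G e r"
  define E where "E = edges B"
  obtain u v where e: "e = {u, v}" using assms(2,8) by (auto simp: simple_graph_def)
  have simpleB: "simple_graph B"
    unfolding B_def edge_ball_def by (rule simple_graph_induced[OF assms(2)])
  have EG: "E \<subseteq> edges G" by (auto simp: E_def B_def edge_ball_def induced_def)
  have finE: "finite E" unfolding E_def B_def by (rule finite_edge_ball(2)[OF assms(2,4,8)])
  have two: "two_sets E" unfolding E_def by (rule simple_graph_two_sets[OF simpleB])
  have forest: "forest E"
    using assms(10) acyclic_forest[OF simpleB] by (simp add: tree_def E_def B_def)
  have deg: "card (nbrs E x) \<le> D" for x
    using card_mono[OF nbrs_edges_degree(1)[OF assms(2,4)] nbrs_mono[OF EG], of x]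
      nbrs_edges_degree(2)[OF assms(2,4), of x] by linarith
  have uvE: "{u, v} \<in> E"
  proof -
    have "x \<in> verts B" if "x \<in> e" for x
    proof -
      have "x \<in> verts G" using assms(2,8) that by (auto simp: simple_graph_def)
      moreover have "(x, x) \<in> arcs (edges G) ^^ 0" by simp
      ultimately show ?thesis
        unfolding B_def edge_ball_verts[OF assms(2,8)] using that by blast
    qed
    then show ?thesis
      using assms(8) unfolding E_def B_def edge_ball_def induced_def e by auto
  qed
  define K where "K = E - {{u, v}}"
  have K: "finite K" "two_sets K" using finE two by (auto simp: K_def)
  have KG: "K \<subseteq> edges G" using EG by (auto simp: K_def)
  \<comment> \<open>The depth \<open>Suc k = r - 1\<close> is the largest at which
    \<open>boundary_far\<close> keeps all walks from \<open>u\<close> and \<open>v\<close> off the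
    boundary; at this depth \<open>mean_ratio\<close> has the exponent \<open>k\<close>.\<close>
  define k where "k = r - 2"
  have rk: "r = Suc (Suc k)" using assms(9) by (simp add: k_def)
  define m where "m b x = msg (\<lambda>f. w f x) b (Suc k) K u + msg (\<lambda>f. w f x) b (Suc k) (avoid K {u}) v" for b x
  define U where "U = {x \<in> space P. m False x \<le> w {u, v} x \<and> w {u, v} x \<le> m True x}"
  \<comment> \<open>The bounds \<open>m\<close> do not depend on \<open>A\<close>, so outside
    \<open>U\<close> the answer is the same for all \<open>A\<close> at once. Only the edges of
    \<open>H\<close> enter, so the ball itself is covered by \<open>A = {}\<close>.\<close>
  have determined: "(w {u, v} x < m False x \<longrightarrow> {u, v} \<notin> max_matching (\<lambda>f. w f x) H)
      \<and> (m True x < w {u, v} x \<longrightarrow> {u, v} \<in> max_matching (\<lambda>f. w f x) H)"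
    if H: "edges H = avoid E A" and A: "A \<subseteq> boundary G B" for H A x
  proof -
    let ?w = "\<lambda>f. w f x"
    have far: "y \<notin> A" if "F \<subseteq> edges G" "z \<in> {u, v}" "j \<le> Suc k" "(z, y) \<in> arcs F ^^ j" for F z j y
    proof -
      have "(z, y) \<in> arcs (edges G) ^^ j"
        using that(4) relpow_mono_set[OF arcs_mono[OF that(1)], of j] by blast
      then have "y \<notin> boundary G B"
        unfolding B_def using that by (intro boundary_far[OF assms(2,8)]) (auto simp: e rk)
      then show ?thesis using A by blast
    qed
    have notA: "u \<notin> A" "v \<notin> A" using far[of "edges G" _ 0] by auto
    have uv: "{u, v} \<in> edges H" using uvE notA by (auto simp: H avoid_def)
    have KH: "edges H - {{u, v}} = avoid K A" by (auto simp: H K_def avoid_def)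
    have comm: "avoid (avoid K A) {u} = avoid (avoid K {u}) A" by (simp add: avoid_avoid)
    have 1: "msg ?w False (Suc k) K u \<le> gain ?w (avoid K A) u \<and> gain ?w (avoid K A) u \<le> msg ?w True (Suc k) K u"
      by (rule msg_sandwich[OF K far[OF KG]]) auto
    have 2: "msg ?w False (Suc k) (avoid K {u}) v \<le> gain ?w (avoid (avoid K {u}) A) v \<and>
        gain ?w (avoid (avoid K {u}) A) v \<le> msg ?w True (Suc k) (avoid K {u}) v"
      by (rule msg_sandwich[OF finite_avoid[OF K(1)] two_sets_avoid[OF K(2)]
            far[OF subset_trans[OF avoid_subset KG]]]) auto
    have "finite (edges H)" by (simp add: H finE)
    from edge_in_max_matching_iff[OF this uv, of ?w] show ?thesis
      unfolding KH comm m_def using 1 2 by auto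
  qed
  have "varrho P w r G e \<le> (\<integral>x. indicat_real U x \<partial>P)"
    unfolding varrho_def
  \<comment> \<open>This rule asks for no measurability of the supremum: a non-integrable function
    has integral 0, which is at most the integral of the nonnegative indicator.\<close>
  proof (rule integral_mono')
    have "U \<in> events"
      unfolding U_def m_def K_def
      by (rule prob_undetermined_le(1)[OF finE two forest EG deg uvE])
    then show "integrable P (indicat_real U)"
      by (intro integrable_real_indicator) (simp_all add: emeasure_eq_measure)
    fix x assume x: "x \<in> space P"
    show "(SUP A\<in>Pow (boundary G (edge_ball G e r)).
        \<bar>indicat_real (max_matching (\<lambda>f. w f x) (edge_ball G e r)) e
          - indicat_real (max_matching (\<lambda>f. w f x) (remove_verts (edge_ball G e r) A)) e\<bar>) \<le> indicat_real U x"
    proof (rule cSUP_least)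
      fix A assume A: "A \<in> Pow (boundary G (edge_ball G e r))"
      then have A': "A \<subseteq> boundary G B" by (simp add: B_def)
      have edges_remove: "edges (remove_verts B A) = avoid E A"
      proof -
        have "f \<subseteq> verts B" if "f \<in> edges B" for f
          using simpleB that by (auto simp: simple_graph_def)
        then show ?thesis by (auto simp: remove_verts_def induced_def avoid_def E_def)
      qed
      have full: "edges B = avoid E {}" by (simp add: E_def)
      show "\<bar>indicat_real (max_matching (\<lambda>f. w f x) (edge_ball G e r)) e
          - indicat_real (max_matching (\<lambda>f. w f x) (remove_verts (edge_ball G e r) A)) e\<bar> \<le> indicat_real U x"
        using determined[OF full empty_subsetI, of x] determined[OF edges_remove A', of x] x
        unfolding B_def[symmetric] unfolding e by (auto simp: U_def indicator_def not_le)
    qed auto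
  qed simp
  also have "\<dots> = prob U" by (simp add: Int_absorb2 U_def)
  also have "\<dots> \<le> 2 * (real D - 1) * (1 - 1 / (2 * real D) ^ D) ^ k"
    unfolding U_def m_def K_def
    by (rule prob_undetermined_le(2)[OF finE two forest EG deg uvE])
  also have "\<dots> \<le> 2 * real D * (1 - 1 / (2 * real D) ^ D) ^ k"
  proof -
    have "1 / (2 * real D) ^ D \<le> 1"
      using one_le_power[of "2 * real D" D] assms(1) by (subst divide_le_eq_1_pos) simp_all
    then show ?thesis by (intro mult_right_mono) auto
  qed
  finally show ?thesis
    by (simp add: k_def power_int_minus divide_inverse)
qed

end
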